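(* Let $Q$ be a spider web quiver with any number of concentric circles and choose two adjacent circles $C,D$. Let $\tau_C$ be the mutation sequence $\mu_1\mu_2\cdots\mu_{n-2}s_{n-1,n}\mu_n\cdots\mu_1$ performed on the vertices $1,\dots,n$ of $C$ (labeled following the arrows), and $\tau_D$ the analogous sequence on $D$. Then applying $\tau_C$, then $\tau_D$, then $\tau_C$ yields the same $y$-variables as applying $\tau_D$, then $\tau_C$, then $\tau_D$.
   Context: Quiver: directed graph without loops or 2-cycles. $y$-seed mutation $\mu_k$: mutate the quiver at $k$ (add $i\to j$ for each $i\to k\to j$, reverse arrows at $k$, cancel 2-cycles), set $y_k'=y_k^{-1}$, and for $i\ne k$ set $y_i'=y_i(1+y_k^{-1})^{-m}$ if there are $m$ arrows $k\to i$, $y_i'=y_i(1+y_k)^m$ if there are $m$ arrows $i\to k$. $s_{n-1,n}$ transposes vertices $n-1,n$; sequences applied rightmost first. Spider web quiver: three or more concentric circles, at least 2 vertices per circle, circle edges oriented counterclockwise, arrows between adjacent circles so each face is a directed cycle with exactly two arrows between circles and at least 3 sides. When the sequence is applied to a circle, that circle plays the role of the middle circle and its neighbors of the outer and inner circles. *)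

theory Defs
  imports Complex_Main
begin

section \<open>Quivers, y-seeds and mutation\<close>

text \<open>A directed multigraph is given by its arrow multiplicities: \<open>Q u v\<close> is the number of
  arrows from \<open>u\<close> to \<open>v\<close>. It is a quiver if it has no loops and no 2-cycles.\<close>

type_synonym 'v arrows = "'v \<Rightarrow> 'v \<Rightarrow> nat"

definition is_quiver :: "'v arrows \<Rightarrow> bool" where
  "is_quiver Q \<longleftrightarrow> (\<forall>v. Q v v = 0) \<and> (\<forall>u v. Q u v = 0 \<or> Q v u = 0)"

text \<open>Removal of a maximal collection of disjoint 2-cycles; the subtraction of natural numbers is
  meant to be truncated.\<close>

definition cancel_2cycles :: "'v arrows \<Rightarrow> 'v arrows" where
  "cancel_2cycles R = (\<lambda>u v. R u v - R v u)"

definition mutate_quiver :: "'v \<Rightarrow> 'v arrows \<Rightarrow> 'v arrows" where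
  "mutate_quiver k Q =
    (let add = (\<lambda>i j. Q i j + Q i k * Q k j);
         rev_k = (\<lambda>i j. if i = k \<or> j = k then add j i else add i j)
     in cancel_2cycles rev_k)"

type_synonym ('v, 'a) seed = "'v arrows \<times> ('v \<Rightarrow> 'a)"

text \<open>In a quiver at most one of \<open>Q i k\<close> and \<open>Q k i\<close> is nonzero, so at most one of the two
  powers below differs from 1.\<close>

definition mutate_y :: "'v \<Rightarrow> 'v arrows \<Rightarrow> ('v \<Rightarrow> 'a::field) \<Rightarrow> 'v \<Rightarrow> 'a" where
  "mutate_y k Q y = (\<lambda>i. if i = k then inverse (y k)
     else y i * (1 + y k) ^ Q i k * inverse ((1 + inverse (y k)) ^ Q k i))"

definition mutate :: "'v \<Rightarrow> ('v, 'a::field) seed \<Rightarrow> ('v, 'a) seed" where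
  "mutate k S = (mutate_quiver k (fst S), mutate_y k (fst S) (snd S))"

definition swap_vertices :: "'v \<Rightarrow> 'v \<Rightarrow> ('v, 'a) seed \<Rightarrow> ('v, 'a) seed" where
  "swap_vertices a b S =
    (let s = (\<lambda>v. if v = a then b else if v = b then a else v)
     in (\<lambda>u v. fst S (s u) (s v), \<lambda>v. snd S (s v)))"

text \<open>For \<open>vs = [v\<^sub>1, \<dots>, v\<^sub>n]\<close> this is
  \<open>\<mu>\<^sub>1 \<mu>\<^sub>2 \<dots> \<mu>\<^sub>n\<^sub>-\<^sub>2 s\<^sub>n\<^sub>-\<^sub>1\<^sub>,\<^sub>n \<mu>\<^sub>n \<dots> \<mu>\<^sub>1\<close>, the rightmost factor acting first: mutate at
  \<open>v\<^sub>1, \<dots>, v\<^sub>n\<close> in this order, exchange \<open>v\<^sub>n\<^sub>-\<^sub>1\<close> and \<open>v\<^sub>n\<close>, and then mutate at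
  \<open>v\<^sub>n\<^sub>-\<^sub>2, \<dots>, v\<^sub>1\<close> in this order. Lists are indexed from 0.\<close>

definition tau :: "'v list \<Rightarrow> ('v, 'a::field) seed \<Rightarrow> ('v, 'a) seed" where
  "tau vs S =
    (let n = length vs
     in fold mutate (rev (take (n - 2) vs))
          (swap_vertices (vs ! (n - 2)) (vs ! (n - 1))
            (fold mutate vs S)))"

text \<open>The y-variables of a seed live in a semifield, realized inside a field: for example the
  subtraction-free rational functions in independent variables inside the field of all rational
  functions, or the positive reals. None of the denominators occurring in mutations vanish there.\<close>

definition semifield_in :: "'a::field set \<Rightarrow> bool" where
  "semifield_in P \<longleftrightarrow> 1 \<in> P \<and> 0 \<notin> P \<and>
     (\<forall>x\<in>P. \<forall>y\<in>P. x + y \<in> P \<and> x * y \<in> P) \<and> (\<forall>x\<in>P. inverse x \<in> P)"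


section \<open>Spider web quivers\<close>

text \<open>
  A drawing on concentric circles, numbered \<open>0, \<dots>, num_circles - 1\<close> from the outside to the
  inside. Circle \<open>c\<close> carries \<open>num_verts c\<close> vertices, numbered counterclockwise, with position
  \<open>i :: int\<close> read modulo \<open>num_verts c\<close>.

  The arrows between circles \<open>c\<close> and \<open>c + 1\<close> are drawn without crossings in the annulus between
  these circles. They are listed counterclockwise as \<open>j = 0, \<dots>, num_cross c - 1\<close>, and the list is
  continued to all \<open>j :: int\<close> by going around the annulus: arrow \<open>j + num_cross c\<close> is arrow \<open>j\<close>
  seen one full turn later. \<open>outer_end c j\<close> and \<open>inner_end c j\<close> are the positions of its endpoints on
  circles \<open>c\<close> and \<open>c + 1\<close>, lifted to the universal cover of the annulus. \<open>inward c j\<close> says that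
  the arrow points from circle \<open>c\<close> to circle \<open>c + 1\<close>.\<close>

record web =
  num_circles :: nat
  num_verts :: "nat \<Rightarrow> nat"
  num_cross :: "nat \<Rightarrow> nat"
  outer_end :: "nat \<Rightarrow> int \<Rightarrow> int"
  inner_end :: "nat \<Rightarrow> int \<Rightarrow> int"
  inward :: "nat \<Rightarrow> int \<Rightarrow> bool"

type_synonym vertex = "nat \<times> nat"

definition vert :: "web \<Rightarrow> nat \<Rightarrow> int \<Rightarrow> vertex" where
  "vert W c i = (c, nat (i mod int (num_verts W c)))"

definition web_verts :: "web \<Rightarrow> vertex set" where
  "web_verts W = {(c, i). c < num_circles W \<and> i < num_verts W c}"

definition circle_arrow :: "web \<Rightarrow> nat \<Rightarrow> int \<Rightarrow> vertex \<times> vertex" where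
  "circle_arrow W c i = (vert W c i, vert W c (i + 1))"

definition cross_arrow :: "web \<Rightarrow> nat \<Rightarrow> int \<Rightarrow> vertex \<times> vertex" where
  "cross_arrow W c j =
    (let a = vert W c (outer_end W c j); b = vert W (Suc c) (inner_end W c j)
     in if inward W c j then (a, b) else (b, a))"

text \<open>Monotonicity of the lifted endpoints expresses that the arrows do not cross.\<close>

definition annular_drawing :: "web \<Rightarrow> nat \<Rightarrow> bool" where
  "annular_drawing W c \<longleftrightarrow>
     (\<forall>j. outer_end W c j \<le> outer_end W c (j + 1) \<and> inner_end W c j \<le> inner_end W c (j + 1)) \<and>
     (\<forall>j. outer_end W c (j + int (num_cross W c)) = outer_end W c j + int (num_verts W c) \<and>
          inner_end W c (j + int (num_cross W c)) = inner_end W c j + int (num_verts W (Suc c)) \<and>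
          inward W c (j + int (num_cross W c)) = inward W c j)"

text \<open>The arrows on the boundary of the face between the consecutive arrows \<open>j\<close> and \<open>j + 1\<close>, in the
  order of a walk around the face: along circle \<open>c\<close> counterclockwise, across arrow \<open>j + 1\<close>, along
  circle \<open>c + 1\<close> clockwise, across arrow \<open>j\<close>. Either of the two arcs may consist of a single
  vertex.\<close>

definition face_sides :: "web \<Rightarrow> nat \<Rightarrow> int \<Rightarrow> (vertex \<times> vertex) list" where
  "face_sides W c j =
     map (circle_arrow W c) [outer_end W c j .. outer_end W c (j + 1) - 1]
     @ [cross_arrow W c (j + 1)]
     @ rev (map (circle_arrow W (Suc c)) [inner_end W c j .. inner_end W c (j + 1) - 1])
     @ [cross_arrow W c j]"

definition directed_cycle :: "('v \<times> 'v) list \<Rightarrow> bool" where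
  "directed_cycle es \<longleftrightarrow> es \<noteq> [] \<and> distinct (map fst es) \<and>
     (\<forall>i<length es. snd (es ! i) = fst (es ! (Suc i mod length es)))"

text \<open>With \<open>num_cross W c \<ge> 2\<close> the arrows \<open>j\<close> and \<open>j + 1\<close> are different, so every face has exactly
  two arrows between the circles. A face may be directed clockwise or counterclockwise, hence the
  two orders of its sides.\<close>

definition spider_web :: "web \<Rightarrow> bool" where
  "spider_web W \<longleftrightarrow>
     num_circles W \<ge> 3 \<and>
     (\<forall>c<num_circles W. num_verts W c \<ge> 2) \<and>
     (\<forall>c. Suc c < num_circles W \<longrightarrow>
        num_cross W c \<ge> 2 \<and> annular_drawing W c \<and>
        (\<forall>j. (directed_cycle (face_sides W c j) \<or> directed_cycle (rev (face_sides W c j))) \<and>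
             length (face_sides W c j) \<ge> 3))"

definition web_arrows :: "web \<Rightarrow> (vertex \<times> vertex) list" where
  "web_arrows W =
     concat (map (\<lambda>c. map (\<lambda>i. circle_arrow W c (int i)) [0..<num_verts W c])
       [0..<num_circles W])
     @ concat (map (\<lambda>c. map (\<lambda>j. cross_arrow W c (int j)) [0..<num_cross W c])
       [0..<num_circles W - 1])"

text \<open>On a circle with exactly two vertices the two circle arrows form a 2-cycle, which bounds no
  face of the drawing. As in mutation, such 2-cycles are cancelled in the quiver.\<close>

definition spider_web_quiver :: "web \<Rightarrow> vertex arrows" where
  "spider_web_quiver W = cancel_2cycles (\<lambda>u v. count_list (web_arrows W) (u, v))"

lemma is_quiver_spider_web_quiver: "is_quiver (spider_web_quiver W)"
  by (auto simp: is_quiver_def spider_web_quiver_def cancel_2cycles_def)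

text \<open>The vertices of circle \<open>c\<close>, labeled following the arrows, starting at position \<open>a\<close>.\<close>

definition circle_from :: "web \<Rightarrow> nat \<Rightarrow> int \<Rightarrow> vertex list" where
  "circle_from W c a = map (\<lambda>i. vert W c (a + int i)) [0..<num_verts W c]"

end

theory Submission
  imports Defs
begin

text \<open>Let \<open>v\<^sub>0 \<rightarrow> \<dots> \<rightarrow> v\<^sub>n\<^sub>-\<^sub>1 \<rightarrow> v\<^sub>0\<close> be a circle, with indices read modulo \<open>n\<close>. Write
  \<open>y\<^sub>i = p\<^sub>i\<^sub>+\<^sub>1 / p\<^sub>i\<close> with \<open>p\<close> quasi-periodic, \<open>p\<^sub>i\<^sub>+\<^sub>n = Y p\<^sub>i\<close>, and let
  \<open>s\<^sub>i = p\<^sub>i\<^sub>+\<^sub>1 + \<dots> + p\<^sub>i\<^sub>+\<^sub>n\<close>. Then \<open>\<tau>\<close> fixes the quiver, replaces \<open>p\<^sub>i\<close> by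
  \<open>p\<^sub>i / (s\<^sub>i\<^sub>-\<^sub>1 s\<^sub>i)\<close>, and multiplies the variable of an outside vertex \<open>x\<close> with
  \<open>v\<^sub>\<beta> \<rightarrow> x \<rightarrow> v\<^sub>\<alpha>\<close>, \<open>\<alpha> < \<beta> < \<alpha> + n\<close>, by \<open>s\<^sub>\<beta> / s\<^sub>\<alpha>\<close>. This follows by induction on \<open>n\<close>:
  after mutation at \<open>v\<^sub>0\<close> the vertices \<open>v\<^sub>1, \<dots>, v\<^sub>n\<^sub>-\<^sub>1\<close> form a shorter circle with \<open>v\<^sub>0\<close>
  outside, whose sequence \<open>p\<close> is obtained by merging \<open>p\<^sub>0\<close> and \<open>p\<^sub>1\<close> and whose sums \<open>s\<^sub>i\<close> are
  unchanged.

  For two adjacent circles with sequences \<open>p\<close>, \<open>q\<close>, each \<open>\<tau>\<close> therefore multiplies the other sequence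
  termwise by window sums read off along the zigzag of cross arrows. The braid relation then says
  that a product of two window sums, one of them iterated, is again a window sum; this is proved by
  telescoping.\<close>

section \<open>The mutation sequence of a circle\<close>

lemma mutate_quiver_same:
  assumes "is_quiver Q"
  shows "mutate_quiver k Q k j = Q j k" "mutate_quiver k Q i k = Q k i"
proof -
  have "Q k k = 0" "\<And>u v. Q u v = 0 \<or> Q v u = 0"
    using assms by (auto simp: is_quiver_def)
  then show "mutate_quiver k Q k j = Q j k" "mutate_quiver k Q i k = Q k i"
    by (auto simp: mutate_quiver_def cancel_2cycles_def) (metis diff_0_eq_0 minus_nat.diff_0)+
qed

lemma mutate_quiver_other:
  assumes "i \<noteq> k" "j \<noteq> k"
  shows "mutate_quiver k Q i j = (Q i j + Q i k * Q k j) - (Q j i + Q j k * Q k i)"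
  using assms by (simp add: mutate_quiver_def cancel_2cycles_def)

lemma is_quiver_mutate_quiver: "is_quiver (mutate_quiver k Q)"
  by (auto simp: is_quiver_def mutate_quiver_def cancel_2cycles_def)

text \<open>Without 2-cycles, the paths of length two through \<open>k\<close> join \<open>i\<close>
  and \<open>j\<close> in one direction only. The second mutation sees these paths reversed and so
  undoes the net change.\<close>

lemma mutate_quiver_involution:
  assumes Q: "is_quiver Q"
  shows "mutate_quiver k (mutate_quiver k Q) = Q"
proof (intro ext)
  fix i j
  have Q': "is_quiver (mutate_quiver k Q)" by (rule is_quiver_mutate_quiver)
  have z: "Q u v = 0 \<or> Q v u = 0" for u v
    using Q by (auto simp: is_quiver_def)
  show "mutate_quiver k (mutate_quiver k Q) i j = Q i j"
  proof (cases "i = k \<or> j = k")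
    case True
    then show ?thesis using mutate_quiver_same[OF Q] mutate_quiver_same[OF Q'] by metis
  next
    case False
    have "Q i k * Q k j = 0 \<or> Q j k * Q k i = 0" using z[of i k] by auto
    then show ?thesis
      using False z[of i j]
      by (auto simp: mutate_quiver_other mutate_quiver_same[OF Q] mult.commute)
  qed
qed

section \<open>Circles in a quiver and their shortening by mutation\<close>

text \<open>The case \<open>a = b\<close> encodes that \<open>w\<close> is not adjacent to the circle; such a vertex arises when
  mutation cancels both of its arrows.\<close>

definition attached :: "'v arrows \<Rightarrow> 'v list \<Rightarrow> 'v \<Rightarrow> nat \<Rightarrow> nat \<Rightarrow> bool" where
  "attached Q vs w a b \<longleftrightarrow> a < length vs \<and> b < length vs \<and>
     (\<forall>i<length vs. Q w (vs ! i) = of_bool (i = a \<and> a \<noteq> b) \<and>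
                    Q (vs ! i) w = of_bool (i = b \<and> a \<noteq> b))"

text \<open>The condition on outside vertices, no arrows or one in each direction, is chosen because
  it survives the passage to a shorter circle. The guard \<open>3 \<le> length vs\<close> reflects
  that the two arrows of a two-vertex circle cancel.\<close>

definition circle_in :: "'v arrows \<Rightarrow> 'v list \<Rightarrow> bool" where
  "circle_in Q vs \<longleftrightarrow> is_quiver Q \<and> 2 \<le> length vs \<and> distinct vs \<and>
     (\<forall>i<length vs. \<forall>j<length vs.
        Q (vs ! i) (vs ! j) = of_bool (3 \<le> length vs \<and> j = Suc i mod length vs)) \<and>
     (\<forall>w. w \<notin> set vs \<longrightarrow> (\<exists>a b. attached Q vs w a b))"

text \<open>Only paths through \<open>v\<close> matter, and positions drop by one. An arrow from
  \<open>w\<close> to \<open>v\<close> creates one to the first vertex of \<open>us\<close>, whence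
  the truncated \<open>a - 1\<close>; an arrow from \<open>v\<close> to \<open>w\<close> creates one
  from the last vertex. If the new ends coincide, the created arrow cancels the existing
  one.\<close>

lemma attached_mutate:
  assumes c: "circle_in Q (v # us)" and us: "2 \<le> length us"
    and w: "w \<notin> set (v # us)" and a: "attached Q (v # us) w a b" and "a \<noteq> b"
  shows "attached (mutate_quiver v Q) us w (a - 1) (if b = 0 then length us - 1 else b - 1)"
proof -
  have Q: "is_quiver Q" using c by (simp add: circle_in_def)
  have d: "v \<notin> set us" using c by (simp add: circle_in_def)
  define n where "n = length us"
  have cc: "Q ((v # us) ! i) ((v # us) ! j) = of_bool (j = Suc i mod Suc n)" if "i < Suc n" "j < Suc n" for i j
    using c that us by (simp add: circle_in_def n_def)
  have v1: "Q v (us ! i) = of_bool (i = 0)" if "i < n" for i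
    using cc[of 0 "Suc i"] that us by (auto simp: n_def)
  have v2: "Q (us ! i) v = of_bool (Suc i = n)" if "i < n" for i
  proof -
    have "(Suc (Suc i) mod Suc n = 0) = (Suc i = n)"
      using that by (cases "Suc i = n") auto
    then show ?thesis using cc[of "Suc i" 0] that by auto
  qed
  have wi: "Q w ((v # us) ! i) = of_bool (i = a)" "Q ((v # us) ! i) w = of_bool (i = b)" if "i < Suc n" for i
    using a that \<open>a \<noteq> b\<close> by (auto simp: attached_def n_def)
  have ab: "a < Suc n" "b < Suc n" using a by (auto simp: attached_def n_def)
  have w0: "Q w v = of_bool (a = 0)" "Q v w = of_bool (b = 0)" using wi[of 0] by auto
  have wS: "Q w (us ! i) = of_bool (a = Suc i)" "Q (us ! i) w = of_bool (b = Suc i)" if "i < n" for i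
    using wi[of "Suc i"] that by auto
  have neq: "us ! i \<noteq> v" if "i < n" for i using d that by (auto simp: n_def)
  have n2: "2 \<le> n" using us by (simp add: n_def)
  show ?thesis
    unfolding attached_def n_def[symmetric]
  proof (intro conjI allI impI)
    show "a - 1 < n" "(if b = 0 then n - 1 else b - 1) < n" using ab n2 by auto
    fix i assume i: "i < n"
    have wv: "w \<noteq> v" using w by auto
    show "mutate_quiver v Q w (us ! i) = of_bool (i = a - 1 \<and> a - 1 \<noteq> (if b = 0 then n - 1 else b - 1))"
      using \<open>a \<noteq> b\<close> i ab n2
      by (auto simp: mutate_quiver_other[OF wv neq[OF i]] w0 wS v1 v2)
    show "mutate_quiver v Q (us ! i) w = of_bool (i = (if b = 0 then n - 1 else b - 1) \<and> a - 1 \<noteq> (if b = 0 then n - 1 else b - 1))"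
      using \<open>a \<noteq> b\<close> i ab n2
      by (auto simp: mutate_quiver_other[OF neq[OF i] wv] w0 wS v1 v2)
  qed
qed

lemma circle_in_Cons_arrows:
  assumes c: "circle_in Q (v # us)" and us: "2 \<le> length us" and i: "i < length us"
  shows "Q v (us ! i) = of_bool (i = 0)" "Q (us ! i) v = of_bool (Suc i = length us)"
    "us ! i \<noteq> v"
    "j < length us \<Longrightarrow> Q (us ! i) (us ! j) = of_bool (j = Suc i)"
proof -
  define n where "n = length us"
  have cc: "Q ((v # us) ! i) ((v # us) ! j) = of_bool (j = Suc i mod Suc n)" if "i < Suc n" "j < Suc n" for i j
    using c that us by (simp add: circle_in_def n_def)
  have m: "Suc (Suc i) mod Suc n = (if Suc i = n then 0 else Suc (Suc i))"
    using i by (auto simp: n_def)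
  show "Q v (us ! i) = of_bool (i = 0)" using cc[of 0 "Suc i"] i us by (auto simp: n_def)
  show "Q (us ! i) v = of_bool (Suc i = length us)" using cc[of "Suc i" 0] i m by (auto simp: n_def)
  show "us ! i \<noteq> v" using c i by (auto simp: circle_in_def)
  show "Q (us ! i) (us ! j) = of_bool (j = Suc i)" if "j < length us"
    using cc[of "Suc i" "Suc j"] i m that by (auto simp: n_def)
qed

text \<open>Reversing its arrows turns \<open>v\<close> into an outside vertex of the shorter
  circle, so the formula for outside vertices will apply to \<open>v\<close> itself.\<close>

lemma attached_mutate_head:
  assumes c: "circle_in Q (v # us)" and us: "2 \<le> length us"
  shows "attached (mutate_quiver v Q) us v (length us - 1) 0"
proof -
  have Q: "is_quiver Q" using c by (simp add: circle_in_def)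
  show ?thesis
    using us circle_in_Cons_arrows[OF c us]
    by (auto simp: attached_def mutate_quiver_same[OF Q])
qed

lemma attached_mutate_none:
  assumes c: "circle_in Q (v # us)" and us: "2 \<le> length us"
    and w: "w \<notin> set (v # us)" and a: "attached Q (v # us) w a a"
  shows "attached (mutate_quiver v Q) us w 0 0"
proof -
  have 0: "Q w ((v # us) ! i) = 0 \<and> Q ((v # us) ! i) w = 0" if "i < Suc (length us)" for i
    using a that by (simp add: attached_def)
  have "Q w v = 0" "Q v w = 0" using 0[of 0] by auto
  moreover have "Q w (us ! i) = 0" "Q (us ! i) w = 0" if "i < length us" for i
    using 0[of "Suc i"] that by auto
  ultimately show ?thesis
    using us w circle_in_Cons_arrows(3)[OF c us]
    by (auto simp: attached_def mutate_quiver_other)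
qed

text \<open>The path from the last vertex of \<open>us\<close> through \<open>v\<close> to the first
  one closes the shorter circle. If \<open>us\<close> has two vertices, the closing arrow instead
  cancels the arrow between them.\<close>

lemma circle_in_mutate:
  assumes c: "circle_in Q (v # us)" and us: "2 \<le> length us"
  shows "circle_in (mutate_quiver v Q) us"
  unfolding circle_in_def
proof (intro conjI allI impI)
  show "is_quiver (mutate_quiver v Q)" by (rule is_quiver_mutate_quiver)
  show "2 \<le> length us" by fact
  show "distinct us" using c by (simp add: circle_in_def)
  note arr = circle_in_Cons_arrows[OF c us]
  fix i j assume i: "i < length us" and j: "j < length us"
  have m: "Suc i mod length us = (if Suc i = length us then 0 else Suc i)" using i by auto
  show "mutate_quiver v Q (us ! i) (us ! j) = of_bool (3 \<le> length us \<and> j = Suc i mod length us)"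
    unfolding m using us i j
    by (auto simp: mutate_quiver_other[OF arr(3)[OF i] arr(3)[OF j]] arr(1,2,4))
next
  fix w assume w: "w \<notin> set us"
  show "\<exists>a b. attached (mutate_quiver v Q) us w a b"
  proof (cases "w = v")
    case True
    then show ?thesis using attached_mutate_head[OF c us] by auto
  next
    case False
    then have w': "w \<notin> set (v # us)" using w by auto
    then obtain a b where ab: "attached Q (v # us) w a b" using c by (auto simp: circle_in_def)
    then show ?thesis
      using attached_mutate[OF c us w' ab] attached_mutate_none[OF c us w', of a] by (cases "a = b") auto
  qed
qed

text \<open>The sequence is nested. The bound on \<open>us\<close> keeps \<open>v\<close> out of the
  swap of the last two vertices.\<close>

lemma tau_Cons:
  assumes "2 \<le> length us"
  shows "tau (v # us) S = mutate v (tau us (mutate v S))"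
proof -
  obtain k where k: "length us = Suc (Suc k)" using assms by (metis add_2_eq_Suc le_Suc_ex)
  show ?thesis by (simp add: tau_def Let_def k)
qed

section \<open>Window sums over one period of a quasi-periodic sequence\<close>

text \<open>Here \<open>ps\<close> is one period of a sequence with \<open>p\<^sub>i\<^sub>+\<^sub>n = Y p\<^sub>i\<close>, and the sum runs over the \<open>n\<close>
  terms after position \<open>i\<close>.\<close>

definition window_sum :: "'a::field list \<Rightarrow> 'a \<Rightarrow> nat \<Rightarrow> 'a" where
  "window_sum ps Y i = sum_list (drop (Suc i) ps) + Y * sum_list (take (Suc i) ps)"

lemma semifield_inD:
  assumes "semifield_in P"
  shows "1 \<in> P" "\<And>x. x \<in> P \<Longrightarrow> x \<noteq> 0" "\<And>x y. x \<in> P \<Longrightarrow> y \<in> P \<Longrightarrow> x + y \<in> P"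
    "\<And>x y. x \<in> P \<Longrightarrow> y \<in> P \<Longrightarrow> x * y \<in> P" "\<And>x. x \<in> P \<Longrightarrow> inverse x \<in> P"
    "\<And>x y. x \<in> P \<Longrightarrow> y \<in> P \<Longrightarrow> x / y \<in> P"
  using assms by (auto simp: semifield_in_def divide_inverse)

lemma semifield_sum:
  assumes "semifield_in P" "finite A" "A \<noteq> {}" "\<And>x. x \<in> A \<Longrightarrow> f x \<in> P"
  shows "sum f A \<in> P"
  using assms(2-4) by (induction rule: finite_ne_induct) (auto simp: semifield_inD[OF assms(1)])

lemma semifield_sum_list:
  assumes "semifield_in P" "set xs \<subseteq> P" "xs \<noteq> []"
  shows "sum_list xs \<in> P"
  using assms(3,2)
  by (induction xs rule: list_nonempty_induct) (auto simp: semifield_inD[OF assms(1)])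

lemma window_sum_in:
  assumes P: "semifield_in P" "set ps \<subseteq> P" "Y \<in> P" "ps \<noteq> []"
  shows "window_sum ps Y i \<in> P"
proof -
  have *: "Y * sum_list (take (Suc i) ps) \<in> P"
    using P by (intro semifield_inD semifield_sum_list) (auto dest: in_set_takeD)
  show ?thesis
  proof (cases "drop (Suc i) ps = []")
    case True
    then show ?thesis using * by (simp add: window_sum_def)
  next
    case False
    then have "sum_list (drop (Suc i) ps) \<in> P"
      using P by (intro semifield_sum_list) (auto dest: in_set_dropD)
    then show ?thesis using * semifield_inD(3)[OF P(1)] by (simp add: window_sum_def)
  qed
qed

text \<open>Moving the window by one position trades the entry \<open>ps ! Suc i\<close> for
  \<open>Y\<close> times itself.\<close>

lemma window_sum_Suc:
  assumes "Suc i < length ps"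
  shows "window_sum ps Y (Suc i) - window_sum ps Y i = (Y - 1) * ps ! Suc i"
proof -
  have "drop (Suc i) ps = ps ! Suc i # drop (Suc (Suc i)) ps" using assms by (rule Cons_nth_drop_Suc[symmetric])
  then show ?thesis using assms by (simp add: window_sum_def take_Suc_conv_app_nth[of "Suc i"] algebra_simps)
qed

text \<open>The same move across the end of the period: \<open>Y * window_sum ps Y 0\<close> is the
  window sum at position \<open>length ps\<close>, where the entry is
  \<open>Y * ps ! 0\<close>.\<close>

lemma window_sum_wrap:
  assumes "ps \<noteq> []"
  shows "Y * window_sum ps Y 0 - window_sum ps Y (length ps - 1) = (Y - 1) * Y * ps ! 0"
  using assms by (cases ps) (auto simp: window_sum_def algebra_simps)

text \<open>Every window of the merged list weights \<open>p\<close> and \<open>q\<close> alike.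
  Only the window at position 0 of the original list, which separates \<open>p\<close> from
  \<open>q\<close>, is lost.\<close>

lemma window_sum_merge: "window_sum ((p + q) # ps) Y i = window_sum (p # q # ps) Y (Suc i)"
  by (simp add: window_sum_def algebra_simps)

text \<open>Quasi-periodicity supplies the window sum at position -1, and in \<open>next_sum\<close>
  the one at position \<open>length ps\<close>.\<close>

abbreviation prev_sum :: "'a::field list \<Rightarrow> 'a \<Rightarrow> nat \<Rightarrow> 'a" where
  "prev_sum ps Y i \<equiv> (if i = 0 then window_sum ps Y (length ps - 1) / Y else window_sum ps Y (i - 1))"

abbreviation next_sum :: "'a::field list \<Rightarrow> 'a \<Rightarrow> nat \<Rightarrow> 'a" where
  "next_sum ps Y i \<equiv> (if Suc i = length ps then Y * window_sum ps Y 0 else window_sum ps Y (Suc i))"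

section \<open>The effect of the mutation sequence on quiver and variables\<close>

text \<open>The factor \<open>Y\<close> for \<open>b < a\<close> moves the end \<open>b\<close> one
  turn ahead, to its first occurrence after \<open>a\<close>. The quotient for circle vertices is
  the effect on p_(i+1) / p_i of dividing each p_i by s_(i-1) s_i.\<close>

definition tau_formula :: "'v arrows \<Rightarrow> 'v list \<Rightarrow> 'a::field list \<Rightarrow> 'a \<Rightarrow> ('v \<Rightarrow> 'a) \<Rightarrow> bool" where
  "tau_formula Q vs ps Y y \<longleftrightarrow> fst (tau vs (Q, y)) = Q \<and>
     (\<forall>w a b. w \<notin> set vs \<longrightarrow> attached Q vs w a b \<longrightarrow>
        snd (tau vs (Q, y)) w =
          y w * (if b < a then Y else 1) * window_sum ps Y b / window_sum ps Y a) \<and>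
     (\<forall>i<length vs. snd (tau vs (Q, y)) (vs ! i) = y (vs ! i) * prev_sum ps Y i / next_sum ps Y i)"

text \<open>There are no arrows between \<open>v\<close> and \<open>w\<close>, and an outside vertex
  sees them through opposite arrows. Reversing the arrows at both therefore amounts to exchanging
  the two vertices, which the swap undoes.\<close>

lemma tau_formula_base:
  fixes y :: "'v \<Rightarrow> 'a::field"
  assumes P: "semifield_in P" and c: "circle_in Q [v, w]"
    and ps: "p \<in> P" "q \<in> P" "Y \<in> P" and y: "y v = q / p" "y w = Y * p / q"
  shows "tau_formula Q [v, w] [p, q] Y y"
proof -
  have Q: "is_quiver Q" using c by (simp add: circle_in_def)
  have vw: "v \<noteq> w" using c by (simp add: circle_in_def)
  have "\<forall>i<2. \<forall>j<2. Q ([v,w] ! i) ([v,w] ! j) = 0"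
    using c by (simp add: circle_in_def)
  then have 0: "Q v w = 0" "Q w v = 0" "Q v v = 0" "Q w w = 0"
    by (auto simp: numeral_2_eq_2 less_Suc_eq all_conj_distrib)
  have nz: "p \<noteq> 0" "q \<noteq> 0" "Y \<noteq> 0" using ps semifield_inD[OF P] by auto
  have in1: "p + q \<in> P" "q + Y * p \<in> P" using ps semifield_inD[OF P] by auto
  then have nz1: "p + q \<noteq> 0" "q + Y * p \<noteq> 0" using semifield_inD[OF P] by blast+
  have ws: "window_sum [p,q] Y 0 = q + Y * p" "window_sum [p,q] Y (Suc 0) = Y * (p + q)"
    by (auto simp: window_sum_def)
  let ?s = "\<lambda>x. if x = v then w else if x = w then v else x"
  let ?Q = "mutate_quiver w (mutate_quiver v Q)"
  have tau: "tau [v, w] (Q, y) = ((\<lambda>a b. ?Q (?s a) (?s b)),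
      (\<lambda>a. mutate_y w (mutate_quiver v Q) (mutate_y v Q y) (?s a)))"
  proof -
    have "tau [v, w] S = swap_vertices v w (mutate w (mutate v S))" for S :: "('v, 'a) seed"
      by (simp add: tau_def Let_def)
    then show ?thesis by (simp add: swap_vertices_def mutate_def Let_def)
  qed
  have Q1: "is_quiver (mutate_quiver v Q)" by (rule is_quiver_mutate_quiver)
  have at2: "\<exists>a b::nat. a < 2 \<and> b < 2 \<and> Q x v = of_bool (0 = a \<and> a \<noteq> b) \<and> Q v x = of_bool (0 = b \<and> a \<noteq> b)
    \<and> Q x w = of_bool (1 = a \<and> a \<noteq> b) \<and> Q w x = of_bool (1 = b \<and> a \<noteq> b)" if "x \<notin> {v,w}" for x
  proof -
    obtain a b where "attached Q [v, w] x a b" using c \<open>x \<notin> {v,w}\<close> by (auto simp: circle_in_def)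
    then show ?thesis
      by (intro exI[of _ a] exI[of _ b]) (auto simp: attached_def numeral_2_eq_2 less_Suc_eq all_conj_distrib)
  qed
  have bal: "Q x v = Q w x \<and> Q v x = Q x w" if x: "x \<notin> {v,w}" for x
    using at2[OF x] by (auto simp: numeral_2_eq_2 less_Suc_eq)
  have z: "Q a b = 0 \<or> Q b a = 0" for a b using Q by (auto simp: is_quiver_def)
  have mv: "mutate_quiver v Q x w = Q x w" "mutate_quiver v Q w x = Q w x" if x: "x \<noteq> v" for x
    using x vw 0 z[of x w] by (auto simp: mutate_quiver_other)
  have q: "?Q (?s a) (?s b) = Q a b" for a b
  proof -
    consider "a \<in> {v,w}" "b \<in> {v,w}" | "a \<in> {v,w}" "b \<notin> {v,w}" | "a \<notin> {v,w}" "b \<in> {v,w}"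
      | "a \<notin> {v,w}" "b \<notin> {v,w}" by blast
    then show ?thesis
    proof cases
      case 1
      then show ?thesis using 0 vw
        by (auto simp: mutate_quiver_same[OF Q1] mutate_quiver_same[OF Q] mutate_quiver_other)
    next
      case 2
      then have "b \<noteq> v" "b \<noteq> w" by auto
      then show ?thesis using 2 0 vw bal[OF 2(2)] z[of b v] z[of b w] z[of v b]
        by (auto simp: mutate_quiver_same[OF Q1] mutate_quiver_same[OF Q] mutate_quiver_other mv)
    next
      case 3
      then have "a \<noteq> v" "a \<noteq> w" by auto
      then show ?thesis using 3 0 vw bal[OF 3(1)] z[of a v] z[of a w] z[of v a]
        by (auto simp: mutate_quiver_same[OF Q1] mutate_quiver_same[OF Q] mutate_quiver_other mv)
    next
      \<comment> \<open>A path from \<open>a\<close> to \<open>b\<close> through \<open>v\<close> is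
        matched by one from \<open>b\<close> to \<open>a\<close> through \<open>w\<close>, so the
        arrows added by the two mutations cancel.\<close>
      case 4
      then have n: "a \<noteq> v" "b \<noteq> v" "a \<noteq> w" "b \<noteq> w" by auto
      have "Q a v = 0 \<or> Q v a = 0" "Q b v = 0 \<or> Q v b = 0" by (rule z)+
      then show ?thesis using n bal[of a] bal[of b] z[of a b]
        by (auto simp: mutate_quiver_other mv mult.commute)
    qed
  qed
  have f: "fst (tau [v, w] (Q, y)) = Q" unfolding tau using q by simp
  have e: "snd (tau [v, w] (Q, y)) x = y x * (if b < a then Y else 1) * window_sum [p,q] Y b / window_sum [p,q] Y a"
    if x: "x \<notin> set [v,w]" and a: "attached Q [v,w] x a b" for x a b
  proof -
    have a2: "a < 2 \<and> b < 2 \<and> Q x v = of_bool (0 = a \<and> a \<noteq> b) \<and> Q v x = of_bool (0 = b \<and> a \<noteq> b)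
      \<and> Q x w = of_bool (1 = a \<and> a \<noteq> b) \<and> Q w x = of_bool (1 = b \<and> a \<noteq> b)"
      using a by (auto simp: attached_def numeral_2_eq_2 less_Suc_eq all_conj_distrib)
    have xs: "x \<noteq> v" "x \<noteq> w" "?s x = x" using x by auto
    have y': "snd (tau [v, w] (Q, y)) x = y x * (1 + y v) ^ Q x v * inverse ((1 + inverse (y v)) ^ Q v x)
       * (1 + y w) ^ Q x w * inverse ((1 + inverse (y w)) ^ Q w x)"
      unfolding tau using xs vw 0 by (simp add: mutate_y_def mv)
    have 1: "1 + y v = (p + q) / p" "1 + inverse (y v) = (p + q) / q"
      "1 + y w = (q + Y * p) / q" "1 + inverse (y w) = (q + Y * p) / (Y * p)"
      using nz by (auto simp: y field_simps)
    have "a = b \<or> a = 0 \<and> b = 1 \<or> a = 1 \<and> b = 0" using a2 by auto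
    then show ?thesis
    proof (elim disjE conjE)
      assume "a = b"
      then show ?thesis using a2 nz nz1 unfolding y' by (auto simp: ws numeral_2_eq_2 less_Suc_eq)
    next
      assume "a = 0" "b = 1"
      then show ?thesis using a2 nz nz1 unfolding y' 1 by (simp add: ws)
    next
      assume "a = 1" "b = 0"
      then show ?thesis using a2 nz nz1 unfolding y' 1 by (simp add: ws)
    qed
  qed
  \<comment> \<open>As \<open>v\<close> and \<open>w\<close> are not adjacent, each ends up with the
    inverse of the other's variable.\<close>
  have "snd (tau [v, w] (Q, y)) v = y v * (window_sum [p,q] Y 1 / Y) / window_sum [p,q] Y 1"
    "snd (tau [v, w] (Q, y)) w = y w * window_sum [p,q] Y 0 / (Y * window_sum [p,q] Y 0)"
    unfolding tau using vw 0 nz nz1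
    by (auto simp: mutate_y_def mutate_quiver_same[OF Q] y ws)
  then have "\<forall>i<length [v,w]. snd (tau [v,w] (Q, y)) ([v,w] ! i) = y ([v,w] ! i) * prev_sum [p,q] Y i / next_sum [p,q] Y i"
    by (auto simp: less_Suc_eq)
  then show ?thesis using f e unfolding tau_formula_def by blast
qed

text \<open>By \<open>tau_Cons\<close> the shorter sequence stands between two mutations at
  \<open>v\<close>, which cancel on the quiver because the inner sequence restores it. On the
  variables, the second mutation at \<open>v\<close> brings in the window sum \<open>s 0\<close>
  that the shorter circle does not see.\<close>

lemma tau_formula_step:
  fixes y :: "'v \<Rightarrow> 'a::field"
  assumes P: "semifield_in P" and c: "circle_in Q (v # us)" and us: "2 \<le> length us"
    and len: "length r + 1 = length us"
    and ps: "set (p # q # r) \<subseteq> P" "Y \<in> P"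
    and yv: "y v = q / p"
    and IH: "tau_formula (mutate_quiver v Q) us ((p + q) # r) Y (mutate_y v Q y)"
  shows "tau_formula Q (v # us) (p # q # r) Y y"
proof -
  define n where "n = length us"
  define s where "s = window_sum (p # q # r) Y"
  define Q1 where "Q1 = mutate_quiver v Q"
  define y1 where "y1 = mutate_y v Q y"
  define y2 where "y2 = snd (tau us (Q1, y1))"
  have n: "2 \<le> n" "length r = n - 1" using us len by (auto simp: n_def)
  have Q: "is_quiver Q" using c by (simp add: circle_in_def)
  have us_v: "v \<notin> set us" using c by (simp add: circle_in_def)
  note arr = circle_in_Cons_arrows[OF c us, folded n_def]
  have merge: "window_sum ((p + q) # r) Y i = s (Suc i)" for i
    by (simp add: s_def window_sum_merge)
  have IH1: "fst (tau us (Q1, y1)) = Q1"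
    and IH2: "\<And>w a b. w \<notin> set us \<Longrightarrow> attached Q1 us w a b \<Longrightarrow>
       y2 w = y1 w * (if b < a then Y else 1) * s (Suc b) / s (Suc a)"
    and IH3: "\<And>i. i < n \<Longrightarrow> y2 (us ! i) = y1 (us ! i) * (if i = 0 then s n / Y else s i) /
       (if Suc i = n then Y * s 1 else s (Suc (Suc i)))"
    using IH n by (auto simp: tau_formula_def merge Q1_def y1_def y2_def n_def)
  have tau: "tau (v # us) (Q, y) = (Q, mutate_y v Q1 y2)"
  proof -
    have "tau us (Q1, y1) = (Q1, y2)" using IH1 by (simp add: y2_def prod_eq_iff)
    moreover have "mutate v (Q, y) = (Q1, y1)" by (simp add: mutate_def Q1_def y1_def)
    moreover have "mutate v (Q1, y2) = (Q, mutate_y v Q1 y2)"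
      by (simp add: mutate_def Q1_def mutate_quiver_involution[OF Q])
    ultimately show ?thesis by (simp add: tau_Cons[OF us])
  qed
  have sP: "s i \<in> P" for i unfolding s_def by (rule window_sum_in[OF P ps]) simp
  have nz: "p \<noteq> 0" "q \<noteq> 0" "p + q \<noteq> 0" "Y \<noteq> 0" "s i \<noteq> 0" for i
    using ps sP semifield_inD(2,3)[OF P] by auto
  \<comment> \<open>This makes \<open>1 + y2 v\<close> factor. It holds because
    \<open>q * (Y * s 0 - s n)\<close> and \<open>p * Y * (s 1 - s 0)\<close> both equal
    \<open>(Y - 1) * Y * p * q\<close>.\<close>
  have key: "q * s n + p * (Y * s 1) = (p + q) * (Y * s 0)"
  proof -
    have 1: "s 1 - s 0 = (Y - 1) * q" using window_sum_Suc[of 0 "p # q # r" Y] by (simp add: s_def)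
    have 2: "Y * s 0 - s n = (Y - 1) * Y * p"
      using window_sum_wrap[of "p # q # r" Y] n by (simp add: s_def)
    have "(p + q) * (Y * s 0) - (q * s n + p * (Y * s 1)) = q * (Y * s 0 - s n) - p * Y * (s 1 - s 0)"
      by (simp add: algebra_simps)
    also have "\<dots> = 0" unfolding 1 2 by simp
    finally show ?thesis by simp
  qed
  have y1v: "y1 v = p / q" by (simp add: y1_def mutate_y_def yv)
  \<comment> \<open>Here \<open>v\<close> lies outside the shorter circle with ends
    \<open>n - 1\<close> and 0; as 0 is the smaller one, a factor \<open>Y\<close> appears.\<close>
  have "y2 v = y1 v * Y * s 1 / s n"
    using IH2[OF us_v, of "n - 1" 0] attached_mutate_head[OF c us, folded n_def Q1_def] n by simp
  then have y2v: "y2 v = p * (Y * s 1) / (q * s n)" by (simp add: y1v)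
  have a1: "1 + y v = (p + q) / p" "1 + inverse (y v) = (p + q) / q"
    using nz by (auto simp: yv field_simps)
  have a2: "1 + y2 v = (p + q) * (Y * s 0) / (q * s n)"
    "1 + inverse (y2 v) = (p + q) * s 0 / (p * s 1)"
  proof -
    have "1 + y2 v = (q * s n + p * (Y * s 1)) / (q * s n)"
      using nz by (simp add: y2v field_simps)
    then show "1 + y2 v = (p + q) * (Y * s 0) / (q * s n)" by (simp only: key)
    have "1 + inverse (y2 v) = (q * s n + p * (Y * s 1)) / (p * (Y * s 1))"
      using nz by (simp add: y2v field_simps)
    also have "\<dots> = (p + q) * s 0 / (p * s 1)" unfolding key using nz by simp
    finally show "1 + inverse (y2 v) = (p + q) * s 0 / (p * s 1)" .
  qed
  \<comment> \<open>An arrow from \<open>x\<close> to \<open>v\<close> contributes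
    \<open>1 + y v\<close> at the first mutation and, being reversed, the inverse of
    \<open>1 + inverse (y2 v)\<close> at the second; symmetrically for arrows from \<open>v\<close>.
    \<open>R\<close> is the factor of the inner sequence.\<close>
  have step: "snd (tau (v # us) (Q, y)) x = y x * (s 1 / s 0) ^ Q x v * (Y * s 0 / s n) ^ Q v x * R"
    if x: "x \<noteq> v" and R: "y2 x = y1 x * R" for x R
  proof -
    have "snd (tau (v # us) (Q, y)) x =
       y2 x * (1 + y2 v) ^ Q v x * inverse ((1 + inverse (y2 v)) ^ Q x v)"
      using x by (simp add: tau mutate_y_def Q1_def mutate_quiver_same[OF Q])
    also have "y2 x = y x * (1 + y v) ^ Q x v * inverse ((1 + inverse (y v)) ^ Q v x) * R"
      using x by (simp add: R y1_def mutate_y_def)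
    also have "\<dots> * (1 + y2 v) ^ Q v x * inverse ((1 + inverse (y2 v)) ^ Q x v)
      = y x * ((1 + y v) / (1 + inverse (y2 v))) ^ Q x v * ((1 + y2 v) / (1 + inverse (y v))) ^ Q v x * R"
      by (simp add: divide_inverse power_mult_distrib power_inverse mult_ac)
    also have "(1 + y v) / (1 + inverse (y2 v)) = s 1 / s 0"
      unfolding a1 a2 using nz by simp
    also have "(1 + y2 v) / (1 + inverse (y v)) = Y * s 0 / s n"
      unfolding a1 a2 using nz by simp
    finally show ?thesis .
  qed
  have ext: "snd (tau (v # us) (Q, y)) x = y x * (if b < a then Y else 1) * s b / s a"
    if x: "x \<notin> set (v # us)" and at: "attached Q (v # us) x a b" for x a b
  proof (cases "a = b")
    case True
    have "attached Q1 us x 0 0"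
      unfolding Q1_def using attached_mutate_none[OF c us x] at True by simp
    then have "y2 x = y1 x * 1" using IH2[of x 0 0] x nz by simp
    moreover have "Q x v = 0" "Q v x = 0" using at True by (auto simp: attached_def)
    ultimately show ?thesis using step[of x 1] x True nz by simp
  next
    case False
    define b' where "b' = (if b = 0 then n - 1 else b - 1)"
    have "attached Q1 us x (a - 1) b'"
      unfolding Q1_def b'_def n_def using attached_mutate[OF c us x at False] .
    then have "y2 x = y1 x * ((if b' < a - 1 then Y else 1) * s (Suc b') / s (Suc (a - 1)))"
      using IH2[of x "a - 1" b'] x by simp
    then have 1: "snd (tau (v # us) (Q, y)) x = y x * (s 1 / s 0) ^ Q x v * (Y * s 0 / s n) ^ Q v x *
       ((if b' < a - 1 then Y else 1) * s (Suc b') / s (Suc (a - 1)))"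
      using x by (intro step) auto
    have 2: "Q x v = of_bool (a = 0)" "Q v x = of_bool (b = 0)" and 3: "a < Suc n" "b < Suc n"
      using at False by (auto simp: attached_def n_def)
    \<comment> \<open>For \<open>a = 0\<close> the inner denominator \<open>s 1\<close> becomes
      \<open>s 0\<close>; for \<open>b = 0\<close> the inner numerator \<open>s n\<close> becomes
      \<open>Y * s 0\<close>.\<close>
    show ?thesis unfolding 1 2 b'_def using 3 False nz n by (cases a; cases b) auto
  qed
  have circ: "snd (tau (v # us) (Q, y)) ((v # us) ! i) = y ((v # us) ! i) *
      (if i = 0 then s n / Y else s (i - 1)) / (if i = n then Y * s 0 else s (Suc i))"
    if i: "i < Suc n" for i
  proof (cases i)
    case 0
    then show ?thesis using n nz by (simp add: tau mutate_y_def y2v yv)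
  next
    case (Suc j)
    then have j: "j < n" using i by simp
    have 1: "snd (tau (v # us) (Q, y)) (us ! j) = y (us ! j) * (s 1 / s 0) ^ Q (us ! j) v * (Y * s 0 / s n) ^ Q v (us ! j) *
       ((if j = 0 then s n / Y else s j) / (if Suc j = n then Y * s 1 else s (Suc (Suc j))))"
      by (rule step) (use IH3[OF j] arr(3)[OF j] in auto)
    show ?thesis using j n nz Suc 1 arr(1,2)[OF j] by (cases "j = 0") auto
  qed
  show ?thesis
    unfolding tau_formula_def
  proof (intro conjI allI impI)
    show "fst (tau (v # us) (Q, y)) = Q" by (simp add: tau)
    show "snd (tau (v # us) (Q, y)) w =
       y w * (if b < a then Y else 1) * window_sum (p # q # r) Y b / window_sum (p # q # r) Y a"
      if "w \<notin> set (v # us)" "attached Q (v # us) w a b" for w a b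
      using ext[OF that] by (simp add: s_def)
    show "snd (tau (v # us) (Q, y)) ((v # us) ! i) = y ((v # us) ! i) *
        prev_sum (p # q # r) Y i / next_sum (p # q # r) Y i" if "i < length (v # us)" for i
      using circ[of i] that n by (auto simp: s_def n_def)
  qed
qed

lemma tau_formula:
  fixes y :: "'v \<Rightarrow> 'a::field"
  assumes P: "semifield_in P" "Y \<in> P"
  assumes "circle_in Q vs" "length ps = length vs" "set ps \<subseteq> P"
    and "\<And>i. i < length vs \<Longrightarrow>
      y (vs ! i) = (if Suc i < length vs then ps ! Suc i else Y * ps ! 0) / ps ! i"
  shows "tau_formula Q vs ps Y y"
  using assms(3-)
proof (induction vs arbitrary: Q ps y)
  case Nil
  then show ?case by (simp add: circle_in_def)
next
  case (Cons v us)
  note c = Cons.prems(1)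
  have "2 \<le> length (v # us)" using c by (simp only: circle_in_def)
  then obtain p q r where ps: "ps = p # q # r" "length us = Suc (length r)"
    using Cons.prems(2) by (cases ps; cases "tl ps") auto
  note y = Cons.prems(4)
  show ?case
  proof (cases "length us = 1")
    case True
    then obtain w where us: "us = [w]" by (auto simp: length_Suc_conv)
    have "r = []" using ps True by simp
    then show ?thesis
      using tau_formula_base[of P Q v w p q Y y] P c ps us y[of 0] y[of 1] Cons.prems(3) by auto
  next
    case False
    then have n: "2 \<le> length us" using ps by (cases r) auto
    note arr = circle_in_Cons_arrows[OF c n]
    have nz: "p \<noteq> 0" "q \<noteq> 0" "p + q \<noteq> 0" 
      using Cons.prems(3) semifield_inD(2,3)[OF P(1)] by (auto simp: ps)
    have yv: "y v = q / p" using y[of 0] ps by simp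
    have "tau_formula (mutate_quiver v Q) us ((p + q) # r) Y (mutate_y v Q y)"
    proof (rule Cons.IH)
      show "circle_in (mutate_quiver v Q) us" by (rule circle_in_mutate[OF c n])
      show "length ((p + q) # r) = length us" using ps by simp
      show "set ((p + q) # r) \<subseteq> P" using Cons.prems(3) semifield_inD(3)[OF P(1)] by (simp add: ps)
      fix i assume i: "i < length us"
      have 1: "y (us ! i) = (if Suc i < length us then r ! i else Y * p) / (q # r) ! i"
        using y[of "Suc i"] i by (simp add: ps)
      have 2: "1 + y v = (p + q) / p" "1 + inverse (y v) = (p + q) / q"
        using nz by (auto simp: yv field_simps)
      \<comment> \<open>The first variable of \<open>us\<close> has denominator \<open>q\<close> and
        is multiplied by \<open>q / (p + q)\<close>; the last has numerator \<open>Y * p\<close> and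
        is multiplied by \<open>(p + q) / p\<close>. Both become ratios of the merged list.\<close>
      show "mutate_y v Q y (us ! i) =
        (if Suc i < length us then ((p + q) # r) ! Suc i else Y * ((p + q) # r) ! 0) / ((p + q) # r) ! i"
        using arr(3)[OF i] n nz i unfolding mutate_y_def arr(1,2)[OF i] 1 2
        by (cases i) auto
    qed
    then show ?thesis
      unfolding ps using P c n ps yv Cons.prems(3) by (intro tau_formula_step) auto
  qed
qed

section \<open>Lifted circles\<close>

definition quasi :: "nat \<Rightarrow> 'a::field \<Rightarrow> (int \<Rightarrow> 'a) \<Rightarrow> bool" where
  "quasi n Y f \<longleftrightarrow> (\<forall>i. f (i + int n) = Y * f i)"

definition wsum :: "nat \<Rightarrow> (int \<Rightarrow> 'a::field) \<Rightarrow> int \<Rightarrow> 'a" where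
  "wsum n f i = (\<Sum>l\<in>{i<..i + int n}. f l)"

lemma quasiD: "quasi n Y f \<Longrightarrow> f (i + int n) = Y * f i"
  by (simp add: quasi_def)

lemma quasi_powi:
  assumes f: "quasi n Y f" and Y: "Y \<noteq> 0"
  shows "f (i + k * int n) = Y powi k * f i"
proof (induction k rule: int_induct[of _ 0])
  case base
  then show ?case by simp
next
  case (step1 k)
  have "f (i + (k + 1) * int n) = Y * f (i + k * int n)"
    using quasiD[OF f, of "i + k * int n"] by (simp add: algebra_simps)
  then show ?case using step1 Y by (simp add: power_int_add_1')
next
  case (step2 k)
  have "f (i + k * int n) = Y * f (i + (k - 1) * int n)"
    using quasiD[OF f, of "i + (k - 1) * int n"] by (simp add: algebra_simps)
  then show ?case using step2 Y by (simp add: power_int_diff)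
qed

lemma quasi_ratio:
  assumes f: "quasi n Y f" and Y: "Y \<noteq> 0"
  shows "f (i + k * int n) / f (j + k * int n) = f i / f j"
  using Y by (simp add: quasi_powi[OF f Y])

lemma wsum_diff:
  assumes "quasi n Y f"
  shows "wsum n f i - wsum n f (i - 1) = (Y - 1) * f i"
proof -
  have "sum f (insert i {i<..i + int n}) = sum f (insert (i + int n) {i - 1<..i - 1 + int n})"
    by (rule arg_cong[of _ _ "sum f"]) auto
  then have "f i + wsum n f i = f (i + int n) + wsum n f (i - 1)"
    by (simp add: wsum_def)
  then show ?thesis using quasiD[OF assms, of i] by (simp add: algebra_simps)
qed

lemma wsum_quasi:
  assumes "quasi n Y f"
  shows "quasi n Y (wsum n f)"
  unfolding quasi_def
proof
  fix i
  have "wsum n f (i + int n) = (\<Sum>l\<in>{i<..i + int n}. f (l + int n))"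
    unfolding wsum_def
    by (rule sum.reindex_bij_witness[of _ "\<lambda>l. l + int n" "\<lambda>l. l - int n"]) auto
  then show "wsum n f (i + int n) = Y * wsum n f i"
    by (simp add: quasiD[OF assms] wsum_def sum_distrib_left)
qed

lemma wsum_in:
  assumes "semifield_in P" "\<And>i. f i \<in> P" "n > 0"
  shows "wsum n f i \<in> P"
  unfolding wsum_def using assms by (intro semifield_sum) auto

text \<open>Both sides grow by \<open>(Y - 1) * f (a + int (Suc i))\<close> from index
  \<open>i\<close> to the next, so only the first window has to be compared.\<close>

lemma window_sum_eq_wsum:
  assumes f: "quasi n Y f" and i: "i < n"
  shows "window_sum (map (\<lambda>i. f (a + int i)) [0..<n]) Y i = wsum n f (a + int i)"
  using i
proof (induction i)
  case 0
  let ?ps = "map (\<lambda>i. f (a + int i)) [0..<n]"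
  have "sum_list ?ps = (\<Sum>i<n. f (a + int i))"
    by (simp add: interv_sum_list_conv_sum_set_nat atLeast0LessThan)
  also have "\<dots> = wsum n f (a - 1)"
    unfolding wsum_def
    by (rule sum.reindex_bij_witness[of _ "\<lambda>l. nat (l - a)" "\<lambda>l. a + int l"]) auto
  finally have "sum_list ?ps = wsum n f (a - 1)" .
  moreover obtain q r where qr: "?ps = q # r" "q = f a"
    using 0 by (cases n) (auto simp: upt_conv_Cons simp del: upt_Suc)
  ultimately have A: "sum_list r = wsum n f (a - 1) - f a" by (metis add_diff_cancel_left' sum_list.Cons)
  have B: "window_sum ?ps Y 0 = sum_list r + Y * f a" unfolding qr(1) by (simp add: window_sum_def qr(2))
  have C: "wsum n f a = wsum n f (a - 1) + (Y - 1) * f a"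
    using wsum_diff[OF f, of a] by (simp add: algebra_simps)
  show ?case by (simp add: A B C algebra_simps)
next
  case (Suc i)
  let ?ps = "map (\<lambda>i. f (a + int i)) [0..<n]"
  have 1: "window_sum ?ps Y (Suc i) - window_sum ?ps Y i = (Y - 1) * f (a + int (Suc i))"
    using window_sum_Suc[of i ?ps Y] Suc.prems by simp
  have 2: "wsum n f (a + int (Suc i)) - wsum n f (a + int i) = (Y - 1) * f (a + int (Suc i))"
    using wsum_diff[OF f, of "a + int (Suc i)"] by simp
  have 3: "window_sum ?ps Y i = wsum n f (a + int i)" using Suc by simp
  show ?case using trans[OF 1 2[symmetric]] unfolding 3 by (simp only: diff_left_imp_eq diff_add_cancel eq_diff_eq)
qed

section \<open>Circles indexed by the integers\<close>

text \<open>The ends are positions on the universal cover, \<open>b\<close> being the first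
  occurrence of its vertex at or after \<open>a\<close>; this absorbs the factor \<open>Y\<close> of
  \<open>tau_formula\<close>. As before, \<open>a = b\<close> means that there are no
  arrows.\<close>

definition attached_lift :: "'v arrows \<Rightarrow> (int \<Rightarrow> 'v) \<Rightarrow> nat \<Rightarrow> 'v \<Rightarrow> int \<Rightarrow> int \<Rightarrow> bool" where
  "attached_lift Q u n x a b \<longleftrightarrow> a \<le> b \<and> b < a + int n \<and>
     (\<forall>i. Q x (u i) = of_bool (a < b \<and> int n dvd i - a) \<and>
          Q (u i) x = of_bool (a < b \<and> int n dvd i - b))"

definition lifted_circle :: "'v arrows \<Rightarrow> (int \<Rightarrow> 'v) \<Rightarrow> nat \<Rightarrow> bool" where
  "lifted_circle Q u n \<longleftrightarrow> is_quiver Q \<and> 2 \<le> n \<and>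
     (\<forall>i j. u i = u j \<longleftrightarrow> int n dvd i - j) \<and>
     (\<forall>i j. Q (u i) (u j) = of_bool (3 \<le> n \<and> int n dvd j - i - 1)) \<and>
     (\<forall>x. x \<notin> range u \<longrightarrow> (\<exists>a b. attached_lift Q u n x a b))"

lemma residue_index:
  fixes c a :: int
  assumes "n > 0"
  obtains c' k where "c' < n" "c = a + int c' + k * int n"
proof
  show "nat ((c - a) mod int n) < n" using assms by (simp add: nat_less_iff)
  show "c = a + int (nat ((c - a) mod int n)) + ((c - a) div int n) * int n"
    using assms by (simp add: algebra_simps)
qed

text \<open>Both \<open>c\<close>, \<open>d\<close> and their residues differ by less than
  \<open>n\<close>, so the turn counts differ by 0 or 1.\<close>

lemma residue_index_pair:
  fixes k k' :: int
  assumes "c' < n" "d' < n" and "c = a + int c' + k * int n" "d = a + int d' + k' * int n"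
    and "c \<le> d" "d < c + int n"
  shows "k' = (if d' < c' then k + 1 else k)" "c < d \<longleftrightarrow> c' \<noteq> d'"
proof -
  have e: "(k' - k) * int n = d - c - int d' + int c'" using assms by (simp add: algebra_simps)
  have "k' - k > -1"
  proof (rule ccontr)
    assume "\<not> k' - k > -1"
    then have "(k' - k) * int n \<le> (-1) * int n" by (intro mult_right_mono) auto
    then show False using assms e by simp
  qed
  moreover have "k' - k < 2"
  proof (rule ccontr)
    assume "\<not> k' - k < 2"
    then have "(k' - k) * int n \<ge> 2 * int n" by (intro mult_right_mono) auto
    then show False using assms e by simp
  qed
  ultimately have "k' - k = 0 \<or> k' - k = 1" by arith
  then have "(k' = k \<and> d - c = int d' - int c') \<or> (k' = k + 1 \<and> int n = d - c - int d' + int c')"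
    using e by auto
  then show "k' = (if d' < c' then k + 1 else k)" "c < d \<longleftrightarrow> c' \<noteq> d'" using assms by auto
qed

text \<open>The circle may be cut open at any position \<open>a\<close>; lifted ends reduced
  relative to \<open>a\<close> become list indices.\<close>

lemma circle_in_lifted:
  fixes a :: int
  assumes l: "lifted_circle Q u n"
  defines "vs \<equiv> map (\<lambda>i. u (a + int i)) [0..<n]"
  shows "circle_in Q vs" "set vs = range u"
    "attached_lift Q u n x c d \<Longrightarrow> c = a + int c' + k * int n \<Longrightarrow> d = a + int d' + k' * int n \<Longrightarrow>
      c' < n \<Longrightarrow> d' < n \<Longrightarrow> attached Q vs x c' d'"
proof -
  have n: "2 \<le> n" and ue: "\<And>i j. u i = u j \<longleftrightarrow> int n dvd i - j"
    and Qu: "\<And>i j. Q (u i) (u j) = of_bool (3 \<le> n \<and> int n dvd j - i - 1)"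
    using l by (auto simp: lifted_circle_def)
  have vs: "length vs = n" "\<And>i. i < n \<Longrightarrow> vs ! i = u (a + int i)" by (auto simp: vs_def)
  show set: "set vs = range u"
  proof
    show "set vs \<subseteq> range u" by (auto simp: vs_def)
    show "range u \<subseteq> set vs"
    proof
      fix x assume "x \<in> range u"
      then obtain j where j: "x = u j" by auto
      obtain c' k where "c' < n" "j = a + int c' + k * int n"
        using residue_index[of n j a] n by auto
      then show "x \<in> set vs" using j by (auto simp: vs_def ue intro!: image_eqI[of _ _ c'])
    qed
  qed
  have dvd: "int n dvd (a + int i) - (a + int j + k * int n) \<longleftrightarrow> i = j" if "i < n" "j < n" for i j k
  proof -
    have "(a + int i) - (a + int j + k * int n) = (int i - int j) - k * int n" by simp
    then have "int n dvd (a + int i) - (a + int j + k * int n) \<longleftrightarrow> int n dvd int i - int j"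
      by (simp only: dvd_diff_left_iff dvd_triv_right)
    also have "\<dots> \<longleftrightarrow> int i mod int n = int j mod int n" by (simp add: mod_eq_dvd_iff)
    also have "\<dots> \<longleftrightarrow> i = j" using that by simp
    finally show ?thesis .
  qed
  show at: "attached Q vs x c' d'"
    if at: "attached_lift Q u n x c d" and "c = a + int c' + k * int n" "d = a + int d' + k' * int n" "c' < n" "d' < n"
    for x c d c' d' k k'
  proof -
    have "c < d \<longleftrightarrow> c' \<noteq> d'"
      using residue_index_pair(2)[OF that(4,5,2,3)] at by (auto simp: attached_lift_def)
    then show ?thesis
      using that dvd by (auto simp: attached_def attached_lift_def vs)
  qed
  show "circle_in Q vs"
    unfolding circle_in_def vs(1)
  proof (intro conjI allI impI)
    show "is_quiver Q" "2 \<le> n" using l n by (auto simp: lifted_circle_def)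
    show "distinct vs" using dvd[of _ _ 0] by (auto simp: distinct_conv_nth vs ue)
    fix i j assume ij: "i < n" "j < n"
    have "int n dvd (a + int j) - (a + int i) - 1 \<longleftrightarrow> int n dvd (int j - int (Suc i))"
      by (simp add: algebra_simps)
    also have "\<dots> \<longleftrightarrow> int j mod int n = int (Suc i) mod int n" by (simp only: mod_eq_dvd_iff)
    also have "\<dots> \<longleftrightarrow> j = Suc i mod n" using ij by (simp only: zmod_int[symmetric] of_nat_eq_iff mod_less)
    finally show "Q (vs ! i) (vs ! j) = of_bool (3 \<le> n \<and> j = Suc i mod n)"
      using ij by (simp add: vs Qu)
  next
    fix x assume "x \<notin> set vs"
    then obtain c d where cd: "attached_lift Q u n x c d"
      using l set by (auto simp: lifted_circle_def)
    obtain c' k where "c' < n" "c = a + int c' + k * int n" using residue_index[of n c a] n by auto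
    moreover obtain d' k' where "d' < n" "d = a + int d' + k' * int n" using residue_index[of n d a] n by auto
    ultimately show "\<exists>a b. attached Q vs x a b" using at[OF cd] by blast
  qed
qed

text \<open>On the cover the factor \<open>Y\<close> and the end cases of \<open>tau_formula\<close>
  disappear, and the formulas are independent of the starting position \<open>a\<close>.\<close>

lemma tau_lifted:
  fixes a :: int and y :: "'v \<Rightarrow> 'a::field"
  assumes P: "semifield_in P" and Y: "Y \<in> P" and l: "lifted_circle Q u n"
    and p: "quasi n Y p" "\<And>i. p i \<in> P" and y: "\<And>i. y (u i) = p (i + 1) / p i"
  defines "T \<equiv> tau (map (\<lambda>i. u (a + int i)) [0..<n]) (Q, y)"
  shows "fst T = Q" "snd T (u i) = y (u i) * wsum n p (i - 1) / wsum n p (i + 1)"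
    "x \<notin> range u \<Longrightarrow> attached_lift Q u n x c d \<Longrightarrow> snd T x = y x * wsum n p d / wsum n p c"
proof -
  define vs where "vs = map (\<lambda>i. u (a + int i)) [0..<n]"
  define ps where "ps = map (\<lambda>i. p (a + int i)) [0..<n]"
  note c = circle_in_lifted[OF l, where a = a, folded vs_def]
  have n: "2 \<le> n" and ue: "\<And>i j. u i = u j \<longleftrightarrow> int n dvd i - j"
    using l by (auto simp: lifted_circle_def)
  have Y0: "Y \<noteq> 0" using Y semifield_inD[OF P] by auto
  have wq: "quasi n Y (wsum n p)" by (rule wsum_quasi[OF p(1)])
  have vs: "length vs = n" "\<And>i. i < n \<Longrightarrow> vs ! i = u (a + int i)" by (auto simp: vs_def)
  have ps: "length ps = n" "\<And>i. i < n \<Longrightarrow> ps ! i = p (a + int i)" by (auto simp: ps_def)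
  have ws: "window_sum ps Y i = wsum n p (a + int i)" if "i < n" for i
    unfolding ps_def by (rule window_sum_eq_wsum[OF p(1) that])
  have f: "tau_formula Q vs ps Y y"
  proof (rule tau_formula[OF P Y c(1)])
    show "length ps = length vs" by (simp add: vs ps)
    show "set ps \<subseteq> P" using p(2) by (auto simp: ps_def)
    fix i assume i: "i < length vs"
    show "y (vs ! i) = (if Suc i < length vs then ps ! Suc i else Y * ps ! 0) / ps ! i"
    proof (cases "Suc i = n")
      case True
      then have e: "a + int i + 1 = a + int n" by simp
      have "p (a + int i + 1) = Y * p a" unfolding e by (rule quasiD[OF p(1)])
      then show ?thesis using i n y True by (simp add: vs ps)
    next
      case False
      then show ?thesis using i n y by (simp add: vs ps algebra_simps)
    qed
  qed
  have T: "T = tau vs (Q, y)" by (simp add: T_def vs_def)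
  show "fst T = Q" using f by (simp add: tau_formula_def T)
  show "snd T x = y x * wsum n p d / wsum n p c" if x: "x \<notin> range u" and at: "attached_lift Q u n x c d" for x c d
  proof -
    obtain c' k where ck: "c' < n" "c = a + int c' + k * int n" using residue_index[of n c a] n by auto
    obtain d' k' where dk: "d' < n" "d = a + int d' + k' * int n" using residue_index[of n d a] n by auto
    have k': "k' = (if d' < c' then k + 1 else k)"
      using residue_index_pair(1)[OF ck(1) dk(1) ck(2) dk(2)] at by (auto simp: attached_lift_def)
    have "snd T x = y x * (if d' < c' then Y else 1) * wsum n p (a + int d') / wsum n p (a + int c')"
      using f c(3)[OF at ck(2) dk(2) ck(1) dk(1)] x c(2) ck dk by (simp add: tau_formula_def T ws)
    \<comment> \<open>The turn count of \<open>d\<close> exceeds that of \<open>c\<close> exactly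
      when \<open>d' < c'\<close>, which accounts for the factor \<open>Y\<close>.\<close>
    then show ?thesis
      using Y0 unfolding ck(2) dk(2) quasi_powi[OF wq Y0] k' by (simp add: power_int_add_1')
  qed
  show "snd T (u i) = y (u i) * wsum n p (i - 1) / wsum n p (i + 1)"
  proof -
    obtain j k where jk: "j < n" "i = a + int j + k * int n" using residue_index[of n i a] n by auto
    have ui: "u i = vs ! j" using jk by (simp add: vs ue)
    have "wsum n p (a + int (n - 1)) = Y * wsum n p (a - 1)"
      using quasiD[OF wq, of "a - 1"] n by (simp add: algebra_simps)
    moreover have "Y * wsum n p a = wsum n p (a + int n)" using quasiD[OF wq, of a] by simp
    ultimately have "snd T (u i) = y (u i) * wsum n p (a + int j - 1) / wsum n p (a + int j + 1)"
      using f jk Y0 n unfolding ui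
      by (auto simp: tau_formula_def T ws vs ps algebra_simps)
    moreover have "wsum n p (i - 1) / wsum n p (i + 1) = wsum n p (a + int j - 1) / wsum n p (a + int j + 1)"
      using quasi_ratio[OF wq Y0, of "a + int j - 1" k "a + int j + 1"] jk(2) by (simp add: algebra_simps)
    ultimately show ?thesis by (metis times_divide_eq_right)
  qed
qed

section \<open>The window sum identity\<close>

lemma wsum_telescope: "wsum n (\<lambda>l. f l - f (l - 1)) i = f (i + int n) - f i"
proof (induction n)
  case 0
  then show ?case by (simp add: wsum_def)
next
  case (Suc n)
  have "{i<..i + int (Suc n)} = insert (i + int (Suc n)) {i<..i + int n}" by auto
  then have "wsum (Suc n) (\<lambda>l. f l - f (l - 1)) i =
    f (i + int (Suc n)) - f (i + int (Suc n) - 1) + wsum n (\<lambda>l. f l - f (l - 1)) i"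
    by (simp add: wsum_def)
  also have "i + int (Suc n) - 1 = i + int n" by simp
  finally show ?case using Suc by simp
qed

lemma wsum_cmult: "wsum n (\<lambda>l. c * f l) i = c * wsum n f i"
  by (simp add: wsum_def sum_distrib_left)

lemma wsum_add: "wsum n (\<lambda>l. f l + g l) i = wsum n f i + wsum n g i"
  by (simp add: wsum_def sum.distrib)

lemma quasi_shift:
  assumes "quasi n Y f"
  shows "quasi n Y (\<lambda>i. f (i - 1))"
  unfolding quasi_def
proof
  fix i
  have "i + int n - 1 = i - 1 + int n" by simp
  then show "f (i + int n - 1) = Y * f (i - 1)" by (simp only: quasiD[OF assms])
qed

text \<open>Telescoping \<open>c / s\<close> gives the identity multiplied by \<open>Z - 1\<close>. For \<open>Z = 1\<close> and \<open>Y \<noteq> 1\<close> one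
  telescopes \<open>a\<^sub>l\<^sub>+\<^sub>1 / s\<^sub>l\<close> instead, and for \<open>Y = Z = 1\<close> all window sums are constant.\<close>

lemma window_identity:
  fixes p r :: "int \<Rightarrow> 'a::field"
  assumes p: "quasi n Y p" and r: "quasi n Z r" and Y0: "Y \<noteq> 0"
    and s0: "\<And>i. wsum n p i \<noteq> 0"
  defines "s \<equiv> wsum n p"
    and "t \<equiv> \<lambda>i. wsum n r (i - 1)"
    and "a \<equiv> \<lambda>i. wsum n (\<lambda>l. r l * wsum n p l) (i - 1)"
    and "c \<equiv> wsum n (\<lambda>l. p l * wsum n r (l - 1))"
  shows "s i * wsum n (\<lambda>l. p l / (s (l - 1) * s l) * a l) i = c i"
proof -
  let ?b = "wsum n (\<lambda>l. p l / (s (l - 1) * s l) * a l)"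
  have sq: "quasi n Y s" unfolding s_def by (rule wsum_quasi[OF p])
  have tq: "quasi n Z t"
    unfolding t_def by (rule quasi_shift[OF wsum_quasi[OF r]])
  have rsq: "quasi n (Y * Z) (\<lambda>l. r l * s l)"
    using r sq by (simp add: quasi_def)
  have ptq: "quasi n (Y * Z) (\<lambda>l. p l * t l)"
    using p tq by (simp add: quasi_def)
  have a_eq: "a = (\<lambda>i. wsum n (\<lambda>l. r l * s l) (i - 1))" by (simp add: a_def s_def)
  have c_eq: "c = wsum n (\<lambda>l. p l * t l)" by (simp add: c_def t_def)
  have aq: "quasi n (Y * Z) a"
    unfolding a_eq by (rule quasi_shift[OF wsum_quasi[OF rsq]])
  have cq: "quasi n (Y * Z) c" using wsum_quasi[OF ptq] by (simp add: c_eq)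
  have sd: "s l = s (l - 1) + (Y - 1) * p l" for l
    using wsum_diff[OF p, of l] by (simp add: s_def algebra_simps)
  have td: "t (l + 1) = t l + (Z - 1) * r l" for l
    using wsum_diff[OF r, of l] by (simp add: t_def algebra_simps)
  have ad: "a (l + 1) = a l + (Y * Z - 1) * (r l * s l)" for l
    using wsum_diff[OF rsq, of l] by (simp add: a_eq algebra_simps)
  have cd: "c l = c (l - 1) + (Y * Z - 1) * (p l * t l)" for l
    using wsum_diff[OF ptq, of l] by (simp add: c_eq algebra_simps)
  have s_nz: "s l \<noteq> 0" for l using s0 by (simp add: s_def)
  \<comment> \<open>Summation by parts: the increments of \<open>s l * t (l + 1)\<close> split into
    the terms summed by \<open>a\<close> and those summed by \<open>c\<close>.\<close>
  have star: "(Y * Z - 1) * (s i * t (i + 1)) = (Z - 1) * a (i + 1) + (Y - 1) * c i" for i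
  proof -
    let ?f = "\<lambda>l. s l * t (l + 1)"
    have "?f (i + int n) - ?f i = wsum n (\<lambda>l. ?f l - ?f (l - 1)) i" by (rule wsum_telescope[symmetric])
    also have "(\<lambda>l. ?f l - ?f (l - 1)) = (\<lambda>l. (Z - 1) * (r l * s l) + (Y - 1) * (p l * t l))"
    proof
      fix l
      have "?f l - ?f (l - 1) = s l * (t (l + 1) - t l) + t l * (s l - s (l - 1))"
        by (simp add: algebra_simps)
      then show "?f l - ?f (l - 1) = (Z - 1) * (r l * s l) + (Y - 1) * (p l * t l)"
        using td[of l] sd[of l] by (simp add: mult_ac)
    qed
    also have "wsum n \<dots> i = (Z - 1) * a (i + 1) + (Y - 1) * c i"
      by (simp add: wsum_add wsum_cmult a_eq c_eq)
    also have "?f (i + int n) - ?f i = (Y * Z - 1) * (s i * t (i + 1))"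
      using quasiD[OF sq, of i] quasiD[OF tq, of "i + 1"] by (simp add: algebra_simps)
    finally show ?thesis .
  qed
  show ?thesis
  proof (cases "Z = 1")
    case False
    \<comment> \<open>By \<open>star\<close>, each increment of this quotient is a multiple of
      \<open>Z - 1\<close>, which can then be divided out.\<close>
    let ?f = "\<lambda>l. c l / s l"
    have "?f (i + int n) - ?f i = wsum n (\<lambda>l. ?f l - ?f (l - 1)) i" by (rule wsum_telescope[symmetric])
    also have "(\<lambda>l. ?f l - ?f (l - 1)) = (\<lambda>l. (Z - 1) * (p l / (s (l - 1) * s l) * a l))"
    proof
      fix l
      have "?f l - ?f (l - 1) = (c l * s (l - 1) - c (l - 1) * s l) / (s (l - 1) * s l)"
        using s_nz by (simp add: field_simps)
      also have "c l * s (l - 1) - c (l - 1) * s l =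
          p l * ((Y * Z - 1) * (s (l - 1) * t l) - (Y - 1) * c (l - 1))"
        unfolding cd[of l] sd[of l] by (simp add: algebra_simps)
      also have "(Y * Z - 1) * (s (l - 1) * t l) = (Z - 1) * a l + (Y - 1) * c (l - 1)"
        using star[of "l - 1"] by simp
      finally show "?f l - ?f (l - 1) = (Z - 1) * (p l / (s (l - 1) * s l) * a l)"
        by (simp add: mult_ac)
    qed
    also have "wsum n \<dots> i = (Z - 1) * ?b i" by (rule wsum_cmult)
    also have "?f (i + int n) - ?f i = (Z - 1) * (c i / s i)"
      using quasiD[OF cq, of i] quasiD[OF sq, of i] Y0 s_nz[of i] by (simp add: field_simps)
    finally have e: "(Z - 1) * (c i / s i) = (Z - 1) * ?b i" .
    have "Z - 1 \<noteq> 0" using False by simp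
    from iffD1[OF mult_left_cancel[OF this] e] have "c i / s i = ?b i" .
    then show ?thesis using s_nz[of i] by (simp add: field_simps)
  next
    case True
    \<comment> \<open>For \<open>Z = 1\<close> the sums \<open>t\<close> are constant, so
      \<open>c\<close> is \<open>t0\<close> times \<open>s\<close> and it remains to show that the
      iterated sum equals \<open>t0\<close>.\<close>
    define t0 where "t0 = t 0"
    have t_eq: "t l = t0" for l
      unfolding t0_def
    proof (induction l rule: int_induct[of _ 0])
      case (step2 j)
      then show ?case using td[of "j - 1"] True by simp
    qed (use td True in auto)
    have c_t: "c l = t0 * s l" for l
      unfolding c_eq t_eq by (simp add: s_def wsum_cmult[symmetric] mult.commute)
    have "?b i = t0"
    proof (cases "Y = 1")
      case True
      define s0 where "s0 = s 0"
      have s_eq: "s l = s0" for l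
        unfolding s0_def
      proof (induction l rule: int_induct[of _ 0])
        case (step1 j)
        then show ?case using sd[of "j + 1"] True by simp
      next
        case (step2 j)
        then show ?case using sd[of j] True by simp
      qed simp
      have a_l: "a l = s0 * t0" for l
      proof -
        have "a l = s0 * t l" unfolding a_eq s_eq t_def by (simp add: wsum_cmult[symmetric] mult.commute)
        then show ?thesis using t_eq by simp
      qed
      have "?b i = wsum n (\<lambda>l. t0 / s0 * p l) i"
        unfolding s_eq a_l using s_nz[of i] by (simp add: s_eq mult.commute)
      also have "\<dots> = t0 / s0 * s i" unfolding s_def by (rule wsum_cmult)
      finally show ?thesis using s_nz[of i] by (simp add: s_eq)
    next
      case False
      \<comment> \<open>For \<open>Z = 1\<close> both \<open>a\<close> and \<open>s\<close> are
        multiplied by \<open>Y\<close> over one turn, so this quotient is periodic and its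
        increments sum to zero.\<close>
      let ?f = "\<lambda>l. a (l + 1) / s l"
      have "?f (i + int n) - ?f i = wsum n (\<lambda>l. ?f l - ?f (l - 1)) i" by (rule wsum_telescope[symmetric])
      also have "(\<lambda>l. ?f l - ?f (l - 1)) = (\<lambda>l. (Y - 1) * r l + (1 - Y) * (p l / (s (l - 1) * s l) * a l))"
      proof
        fix l
        have "?f l - ?f (l - 1) = (a (l + 1) * s (l - 1) - a l * s l) / (s (l - 1) * s l)"
          using s_nz by (simp add: field_simps)
        also have "a (l + 1) * s (l - 1) - a l * s l = (Y - 1) * r l * (s (l - 1) * s l) - (Y - 1) * p l * a l"
        proof -
          have "a (l + 1) * s (l - 1) - a l * s l = (Y - 1) * r l * (s (l - 1) * s l) + a l * (s (l - 1) - s l)"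
            unfolding ad[of l] using \<open>Z = 1\<close> by (simp add: algebra_simps)
          also have "s (l - 1) - s l = - ((Y - 1) * p l)" using sd[of l] by simp
          finally show ?thesis by simp
        qed
        finally show "?f l - ?f (l - 1) = (Y - 1) * r l + (1 - Y) * (p l / (s (l - 1) * s l) * a l)"
          using s_nz by (simp add: field_simps)
      qed
      also have "wsum n \<dots> i = (Y - 1) * t (i + 1) + (1 - Y) * ?b i"
        unfolding wsum_add wsum_cmult by (simp add: t_def)
      also have "?f (i + int n) - ?f i = 0"
        using quasiD[OF aq, of "i + 1"] quasiD[OF sq, of i] Y0 s_nz[of i] \<open>Z = 1\<close>
        by (simp add: algebra_simps)
      finally have "(Y - 1) * (t (i + 1) - ?b i) = 0" by (simp add: algebra_simps)
      then show ?thesis using False t_eq[of "i + 1"] by simp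
    qed
    then show ?thesis by (simp add: c_t mult.commute)
  qed
qed

section \<open>The braid relation for two adjacent circles\<close>

text \<open>A multiplicative primitive of the variables, with \<open>Y\<close> their product over
  one turn. Membership in \<open>P\<close> keeps the window sums nonzero.\<close>

definition potential :: "'a::field set \<Rightarrow> (int \<Rightarrow> 'v) \<Rightarrow> nat \<Rightarrow> ('v \<Rightarrow> 'a) \<Rightarrow> 'a \<Rightarrow> (int \<Rightarrow> 'a) \<Rightarrow> bool" where
  "potential P u n y Y p \<longleftrightarrow>
     Y \<in> P \<and> quasi n Y p \<and> (\<forall>i. p i \<in> P) \<and> (\<forall>i. y (u i) = p (i + 1) / p i)"

lemma potentialD: "potential P u n y Y p \<Longrightarrow> y (u i) = p (i + 1) / p i"
  by (simp add: potential_def)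

lemma potential_exists:
  assumes P: "semifield_in P" and u: "\<And>i. u (i + int n) = u i" and y: "\<And>i. y (u i) \<in> P"
  shows "\<exists>Y p. potential P u n y Y p"
proof -
  \<comment> \<open>Products are taken in both directions from \<open>p 0 = 1\<close>, so that the
    recursion \<open>step\<close> holds at all integers.\<close>
  define p where "p i = (if 0 \<le> i then \<Prod>l\<in>{0..<i}. y (u l) else inverse (\<Prod>l\<in>{i..<0}. y (u l)))" for i
  have prod: "finite A \<Longrightarrow> (\<Prod>l\<in>A. y (u l)) \<in> P" for A :: "int set"
    by (induction rule: finite_induct) (auto simp: semifield_inD[OF P] y)
  have nz: "y (u i) \<noteq> 0" for i using y semifield_inD(2)[OF P] by auto
  have pP: "p i \<in> P" for i by (simp add: p_def prod semifield_inD(5)[OF P])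
  have p0: "p i \<noteq> 0" for i using pP semifield_inD(2)[OF P] by auto
  have step: "p (i + 1) = y (u i) * p i" for i
  proof -
    consider "i \<ge> 0" | "i = - 1" | "i < - 1" by linarith
    then show ?thesis
    proof cases
      case 1
      then have "{0..<i + 1} = insert i {0..<i}" by auto
      then show ?thesis using 1 by (simp add: p_def)
    next
      case 2
      have "{- 1..<0} = {- 1 :: int}" by auto
      then show ?thesis using 2 nz by (simp add: p_def)
    next
      case 3
      then have "{i..<0} = insert i {i + 1..<0}" by auto
      then show ?thesis using 3 nz by (simp add: p_def)
    qed
  qed
  have "p (i + int n) = p (int n) * p i" for i
  proof (induction i rule: int_induct[of _ 0])
    case base
    then show ?case by (simp add: p_def)
  next
    case (step1 i)
    then show ?case using step[of "i + int n"] step[of i] u[of i] by (simp add: algebra_simps)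
  next
    case (step2 i)
    have "y (u (i - 1)) * p (i - 1 + int n) = y (u (i - 1)) * (p (int n) * p (i - 1))"
      using step[of "i - 1 + int n"] step[of "i - 1"] u[of "i - 1"] step2 by (auto simp: algebra_simps)
    then show ?case using nz by simp
  qed
  then have "potential P u n y (p (int n)) p"
    using pP p0 step by (simp add: potential_def quasi_def)
  then show ?thesis by blast
qed

section \<open>Two adjacent circles\<close>

text \<open>The lifted endpoints of the zigzag between the circles: \<open>w j\<close> has an arrow to \<open>u (h j)\<close> and
  one from \<open>u (h (j + 1))\<close>, unless these positions agree; likewise for \<open>u i\<close> and \<open>g\<close>. The Galois
  condition expresses that \<open>h\<close> and \<open>g\<close> describe the same zigzag.\<close>

locale two_circles =
  fixes P :: "'a::field set" and Q :: "'v arrows" and u w :: "int \<Rightarrow> 'v" and n m :: nat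
    and g h :: "int \<Rightarrow> int"
  assumes P: "semifield_in P"
    and cu: "lifted_circle Q u n" and cw: "lifted_circle Q w m"
    and disj: "\<And>i j. u i \<noteq> w j"
    and att_w: "\<And>j. attached_lift Q u n (w j) (h j) (h (j + 1))"
    and att_u: "\<And>i. attached_lift Q w m (u i) (g i) (g (i + 1))"
    and galois: "\<And>i j. h j < i \<longleftrightarrow> j \<le> g i"
    and h_per: "\<And>j. h (j + int m) = h j + int n"
    and g_per: "\<And>i. g (i + int n) = g i + int m"
begin

text \<open>Contraposition makes the Galois condition symmetric; hence every fact about
  \<open>u\<close> also holds for \<open>w\<close>.\<close>

lemma swapped: "two_circles P Q w u m n h g"
proof
  show "g i < j \<longleftrightarrow> i \<le> h j" for i j using galois[of j i] by auto
qed (use P cu cw disj[symmetric] att_w att_u h_per g_per in auto)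

lemma n_pos: "n > 0" and m_pos: "m > 0"
  using cu cw by (auto simp: lifted_circle_def)

lemma g_mono: "i \<le> i' \<Longrightarrow> g i \<le> g i'"
  using galois[of "g i" i] galois[of "g i" i'] by auto

text \<open>The vertex \<open>w j\<close> gains the factor \<open>s (h (j + 1)) / s (h j)\<close>,
  which multiplies the potential of its circle by \<open>s (h j)\<close>. As the quiver is restored
  and both circles keep a potential, the lemma can be iterated.\<close>

lemma tau_u:
  fixes b :: int
  assumes p: "potential P u n y Y p" and q: "potential P w m y Z q"
  defines "T \<equiv> tau (map (\<lambda>i. u (b + int i)) [0..<n]) (Q, y)"
    and "s \<equiv> wsum n p"
  shows "T = (Q, snd T)"
    and "potential P u n (snd T) (1 / Y) (\<lambda>i. p i / (s (i - 1) * s i))"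
    and "potential P w m (snd T) (Y * Z) (\<lambda>j. q j * s (h j))"
    and "x \<notin> range u \<Longrightarrow> attached_lift Q u n x c d \<Longrightarrow> snd T x = y x * s d / s c"
proof -
  have Y: "Y \<in> P" and pq: "quasi n Y p" and pP: "\<And>i. p i \<in> P" and py: "\<And>i. y (u i) = p (i + 1) / p i"
    using p by (auto simp: potential_def)
  have Z: "Z \<in> P" and qq: "quasi m Z q" and qP: "\<And>i. q i \<in> P" and qy: "\<And>i. y (w i) = q (i + 1) / q i"
    using q by (auto simp: potential_def)
  note tau = tau_lifted[where y = y, OF P Y cu pq pP py]
  have t: "fst T = Q" "\<And>i. snd T (u i) = y (u i) * s (i - 1) / s (i + 1)"
    unfolding T_def s_def by (rule tau(1), rule tau(2))
  have sq: "quasi n Y s" unfolding s_def by (rule wsum_quasi[OF pq])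
  have sP: "s i \<in> P" for i unfolding s_def by (rule wsum_in[OF P pP n_pos])
  have nz: "s i \<noteq> 0" "p i \<noteq> 0" "q i \<noteq> 0" "Y \<noteq> 0" for i
    using sP pP qP Y semifield_inD(2)[OF P] by auto
  show "T = (Q, snd T)" using t(1) by (simp add: prod_eq_iff)
  show "potential P u n (snd T) (1 / Y) (\<lambda>i. p i / (s (i - 1) * s i))"
    unfolding potential_def
  proof (intro conjI allI)
    show "1 / Y \<in> P" "p i / (s (i - 1) * s i) \<in> P" for i
      by (rule semifield_inD(6)[OF P] semifield_inD(1)[OF P] semifield_inD(4)[OF P] Y pP sP)+
    show "quasi n (1 / Y) (\<lambda>i. p i / (s (i - 1) * s i))"
      unfolding quasi_def
    proof
      fix i
      have "s (i + int n - 1) = Y * s (i - 1)" using quasiD[OF sq, of "i - 1"] by (simp add: algebra_simps)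
      then show "p (i + int n) / (s (i + int n - 1) * s (i + int n)) = 1 / Y * (p i / (s (i - 1) * s i))"
        using nz by (simp add: quasiD[OF sq] quasiD[OF pq])
    qed
    show "snd T (u i) = p (i + 1) / (s (i + 1 - 1) * s (i + 1)) / (p i / (s (i - 1) * s i))" for i
      using nz by (simp add: t(2) py)
  qed
  show ext: "snd T x = y x * s d / s c" if "x \<notin> range u" "attached_lift Q u n x c d" for x c d
    unfolding T_def s_def using that by (rule tau(3))
  show "potential P w m (snd T) (Y * Z) (\<lambda>j. q j * s (h j))"
    unfolding potential_def
  proof (intro conjI allI)
    show "Y * Z \<in> P" "q j * s (h j) \<in> P" for j
      by (rule semifield_inD(4)[OF P] Y Z qP sP)+
    show "quasi m (Y * Z) (\<lambda>j. q j * s (h j))"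
      by (simp add: quasi_def h_per quasiD[OF sq] quasiD[OF qq])
    have "w j \<notin> range u" for j using disj by (metis rangeE)
    then show "snd T (w j) = q (j + 1) * s (h (j + 1)) / (q j * s (h j))" for j
      using ext[OF _ att_w] by (simp add: qy)
  qed
qed

text \<open>Monotonicity of \<open>g\<close> makes successive blocks adjacent. This converts windows
  on one circle into windows on the other.\<close>

lemma block_sum:
  "wsum k (\<lambda>l. \<Sum>j\<in>{g l<..g (l + 1)}. f j) (i - 1) = (\<Sum>j\<in>{g i<..g (i + int k)}. f j)"
proof (induction k)
  case 0
  then show ?case by (simp add: wsum_def)
next
  case (Suc k)
  have "{i - 1<..i - 1 + int (Suc k)} = insert (i + int k) {i - 1<..i - 1 + int k}" by auto
  then have "wsum (Suc k) (\<lambda>l. \<Sum>j\<in>{g l<..g (l + 1)}. f j) (i - 1) =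
     (\<Sum>j\<in>{g (i + int k)<..g (i + int k + 1)}. f j) + (\<Sum>j\<in>{g i<..g (i + int k)}. f j)"
    using Suc by (simp add: wsum_def)
  also have "\<dots> = (\<Sum>j\<in>{g (i + int k)<..g (i + int k + 1)} \<union> {g i<..g (i + int k)}. f j)"
    by (rule sum.union_disjoint[symmetric]) auto
  also have "{g (i + int k)<..g (i + int k + 1)} \<union> {g i<..g (i + int k)} = {g i<..g (i + int (Suc k))}"
    using g_mono[of i "i + int k"] g_mono[of "i + int k" "i + int k + 1"] by (auto simp: algebra_simps)
  finally show ?case .
qed

text \<open>The positions \<open>j\<close> on \<open>w\<close> are grouped by the value
  \<open>h j\<close>. With all sums indexed by positions on \<open>u\<close>,
  \<open>window_identity\<close> applies although \<open>n\<close> and \<open>m\<close> may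
  differ.\<close>

lemma composite_window:
  assumes p: "potential P u n y Y p" and q: "potential P w m y Z q"
  defines "s \<equiv> wsum n p" and "t \<equiv> wsum m q"
  defines "c \<equiv> wsum n (\<lambda>i. p i * t (g i))" and "a \<equiv> wsum m (\<lambda>j. q j * s (h j))"
  shows "s i * wsum n (\<lambda>i. p i / (s (i - 1) * s i) * a (g i)) i = c i"
proof -
  have Y: "Y \<in> P" and pq: "quasi n Y p" and pP: "\<And>i. p i \<in> P"
    using p by (auto simp: potential_def)
  have qq: "quasi m Z q" using q by (auto simp: potential_def)
  define r where "r l = (\<Sum>j\<in>{g l<..g (l + 1)}. q j)" for l
  have rq: "quasi n Z r"
    unfolding quasi_def
  proof
    fix i
    have "i + int n + 1 = (i + 1) + int n" by simp
    then have "r (i + int n) = (\<Sum>j\<in>{g i + int m<..g (i + 1) + int m}. q j)"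
      unfolding r_def by (simp only: g_per)
    also have "\<dots> = (\<Sum>j\<in>{g i<..g (i + 1)}. q (j + int m))"
      by (rule sum.reindex_bij_witness[of _ "\<lambda>j. j + int m" "\<lambda>j. j - int m"]) auto
    finally show "r (i + int n) = Z * r i"
      by (simp add: r_def quasiD[OF qq] sum_distrib_left)
  qed
  have t: "t (g l) = wsum n r (l - 1)" for l
    unfolding r_def block_sum g_per by (simp add: t_def wsum_def)
  have "r l * s l = (\<Sum>j\<in>{g l<..g (l + 1)}. q j * s (h j))" for l
    unfolding r_def sum_distrib_right
  proof (rule sum.cong[OF refl])
    fix j assume "j \<in> {g l<..g (l + 1)}"
    \<comment> \<open>By the Galois condition the block from \<open>g l\<close> to
      \<open>g (l + 1)\<close> is the fibre of \<open>h\<close> over \<open>l\<close>.\<close>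
    then have "h j = l" using galois[of j l] galois[of j "l + 1"] by auto
    then show "q j * s l = q j * s (h j)" by simp
  qed
  then have a: "a (g l) = wsum n (\<lambda>l. r l * s l) (l - 1)" for l
    by (simp add: block_sum g_per a_def) (simp add: wsum_def)
  have "Y \<noteq> 0" "s i \<noteq> 0" for i
    using Y wsum_in[OF P pP n_pos] semifield_inD(2)[OF P] by (auto simp: s_def)
  then have "s i * wsum n (\<lambda>l. p l / (s (l - 1) * s l) * a (g l)) i = wsum n (\<lambda>l. p l * t (g l)) i"
    unfolding a t s_def by (intro window_identity[OF pq rq])
  then show ?thesis by (simp add: c_def)
qed

text \<open>Each side is followed through three applications of \<open>tau_u\<close>, with window
  sums \<open>s\<close>, \<open>a\<close>, \<open>B\<close> on one side and \<open>t\<close>,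
  \<open>c\<close>, \<open>E\<close> on the other. The relations \<open>s i * B i = c i\<close> and
  \<open>t j * E j = a j\<close> identify the outcomes.\<close>

lemma braid:
  fixes b b' :: int
  assumes yu: "\<And>i. y (u i) \<in> P" and yw: "\<And>j. y (w j) \<in> P"
  defines "\<tau> \<equiv> tau (map (\<lambda>i. u (b + int i)) [0..<n])" and "\<tau>' \<equiv> tau (map (\<lambda>j. w (b' + int j)) [0..<m])"
  shows "snd (\<tau> (\<tau>' (\<tau> (Q, y)))) x = snd (\<tau>' (\<tau> (\<tau>' (Q, y)))) x"
proof -
  interpret sw: two_circles P Q w u m n h g by (rule swapped)
  have per: "u (i + int n) = u i" "w (i + int m) = w i" for i
    using cu cw by (auto simp: lifted_circle_def)
  obtain Y p where p: "potential P u n y Y p"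
    using potential_exists[of P u n y, OF P per(1) yu] by blast
  obtain Z q where q: "potential P w m y Z q"
    using potential_exists[of P w m y, OF P per(2) yw] by blast
  define s where "s = wsum n p"
  define t where "t = wsum m q"
  define a where "a = wsum m (\<lambda>j. q j * s (h j))"
  define c where "c = wsum n (\<lambda>i. p i * t (g i))"
  define B where "B = wsum n (\<lambda>i. p i / (s (i - 1) * s i) * a (g i))"
  define E where "E = wsum m (\<lambda>j. q j / (t (j - 1) * t j) * c (h j))"

  define y1 where "y1 = snd (\<tau> (Q, y))"
  define y2 where "y2 = snd (\<tau>' (Q, y1))"
  define y3 where "y3 = snd (\<tau> (Q, y2))"
  define z1 where "z1 = snd (\<tau>' (Q, y))"
  define z2 where "z2 = snd (\<tau> (Q, z1))"
  define z3 where "z3 = snd (\<tau>' (Q, z2))"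

  note t = tau_u[OF p q, where b = b, folded \<tau>_def]
  have L1: "\<tau> (Q, y) = (Q, y1)"
      "potential P u n y1 (1 / Y) (\<lambda>i. p i / (s (i - 1) * s i))"
      "potential P w m y1 (Y * Z) (\<lambda>j. q j * s (h j))"
    unfolding y1_def s_def by (rule t(1), rule t(2), rule t(3))
  have L1x: "y1 x = y x * s d0 / s c0"
    if "x \<notin> range u" "attached_lift Q u n x c0 d0" for x c0 d0
    unfolding y1_def s_def using that by (rule t(4))
  note t = sw.tau_u[OF L1(3,2), where b = b', folded \<tau>'_def]
  have L2: "\<tau>' (Q, y1) = (Q, y2)"
      "potential P w m y2 (1 / (Y * Z)) (\<lambda>j. q j * s (h j) / (a (j - 1) * a j))"
      "potential P u n y2 (Y * Z * (1 / Y)) (\<lambda>i. p i / (s (i - 1) * s i) * a (g i))"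
    unfolding y2_def a_def by (rule t(1), rule t(2), rule t(3))
  have L2x: "y2 x = y1 x * a d0 / a c0"
    if "x \<notin> range w" "attached_lift Q w m x c0 d0" for x c0 d0
    unfolding y2_def a_def using that by (rule t(4))
  note t = tau_u[OF L2(3,2), where b = b, folded \<tau>_def]
  have L3: "\<tau> (Q, y2) = (Q, y3)"
      "potential P u n y3 (1 / (Y * Z * (1 / Y))) (\<lambda>i. p i / (s (i - 1) * s i) * a (g i) / (B (i - 1) * B i))"
      "potential P w m y3 (Y * Z * (1 / Y) * (1 / (Y * Z))) (\<lambda>j. q j * s (h j) / (a (j - 1) * a j) * B (h j))"
    unfolding y3_def B_def by (rule t(1), rule t(2), rule t(3))
  have L3x: "y3 x = y2 x * B d0 / B c0"
    if "x \<notin> range u" "attached_lift Q u n x c0 d0" for x c0 d0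
    unfolding y3_def B_def using that by (rule t(4))
  note tt = sw.tau_u[OF q p, where b = b', folded \<tau>'_def]
  have R1: "\<tau>' (Q, y) = (Q, z1)"
      "potential P w m z1 (1 / Z) (\<lambda>j. q j / (t (j - 1) * t j))"
      "potential P u n z1 (Z * Y) (\<lambda>i. p i * t (g i))"
    unfolding z1_def t_def by (rule tt(1), rule tt(2), rule tt(3))
  have R1x: "z1 x = y x * t d0 / t c0"
    if "x \<notin> range w" "attached_lift Q w m x c0 d0" for x c0 d0
    unfolding z1_def t_def using that by (rule tt(4))
  note t = tau_u[OF R1(3,2), where b = b, folded \<tau>_def]
  have R2: "\<tau> (Q, z1) = (Q, z2)"
      "potential P u n z2 (1 / (Z * Y)) (\<lambda>i. p i * t (g i) / (c (i - 1) * c i))"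
      "potential P w m z2 (Z * Y * (1 / Z)) (\<lambda>j. q j / (t (j - 1) * t j) * c (h j))"
    unfolding z2_def c_def by (rule t(1), rule t(2), rule t(3))
  have R2x: "z2 x = z1 x * c d0 / c c0"
    if "x \<notin> range u" "attached_lift Q u n x c0 d0" for x c0 d0
    unfolding z2_def c_def using that by (rule t(4))
  note t = sw.tau_u[OF R2(3,2), where b = b', folded \<tau>'_def]
  have R3: "\<tau>' (Q, z2) = (Q, z3)"
      "potential P w m z3 (1 / (Z * Y * (1 / Z))) (\<lambda>j. q j / (t (j - 1) * t j) * c (h j) / (E (j - 1) * E j))"
      "potential P u n z3 (Z * Y * (1 / Z) * (1 / (Z * Y))) (\<lambda>i. p i * t (g i) / (c (i - 1) * c i) * E (g i))"
    unfolding z3_def E_def by (rule t(1), rule t(2), rule t(3))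
  have R3x: "z3 x = z2 x * E d0 / E c0"
    if "x \<notin> range w" "attached_lift Q w m x c0 d0" for x c0 d0
    unfolding z3_def E_def using that by (rule t(4))
  have y3: "snd (\<tau> (\<tau>' (\<tau> (Q, y)))) = y3" and z3: "snd (\<tau>' (\<tau> (\<tau>' (Q, y)))) = z3"
    unfolding L1(1) L2(1) L3(1) R1(1) R2(1) R3(1) by simp_all

  have sB: "s i * B i = c i" for i
    using composite_window[OF p q, of i] by (simp add: s_def t_def a_def c_def B_def)
  have tE: "t j * E j = a j" for j
    using sw.composite_window[OF q p, of j] by (simp add: s_def t_def a_def c_def E_def)
  have nz: "s i \<noteq> 0" "t j \<noteq> 0" for i j
    using p q wsum_in[OF P, of p n] wsum_in[OF P, of q m] n_pos m_pos semifield_inD(2)[OF P]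
    by (auto simp: potential_def s_def t_def)
  have B: "B i = c i / s i" and E: "E j = a j / t j" for i j
    using sB[of i] tE[of j] nz by (auto simp: field_simps)
  have "y3 x = z3 x"
  proof -
    consider (u) i where "x = u i" | (w) j where "x = w j" | (ext) "x \<notin> range u" "x \<notin> range w" by blast
    then show ?thesis
    proof cases
      \<comment> \<open>Once \<open>B\<close> and \<open>E\<close> are eliminated, the two final
        potentials of this circle are the same function.\<close>
      case u
      have "(\<lambda>i. p i / (s (i - 1) * s i) * a (g i) / (B (i - 1) * B i)) =
         (\<lambda>i. p i * t (g i) / (c (i - 1) * c i) * E (g i))"
        using nz by (simp add: B E)
      from potentialD[OF L3(2)[unfolded this]] show ?thesis
        unfolding u potentialD[OF R3(3)] .
    next
      case w
      have "(\<lambda>j. q j / (t (j - 1) * t j) * c (h j) / (E (j - 1) * E j)) =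
         (\<lambda>j. q j * s (h j) / (a (j - 1) * a j) * B (h j))"
        using nz by (simp add: B E)
      from potentialD[OF R3(2)[unfolded this]] show ?thesis
        unfolding w potentialD[OF L3(3)] by (rule sym)
    next
      \<comment> \<open>Such a vertex may be attached to both circles. On either side its total
        factor is a quotient of values of \<open>c\<close> times a quotient of values of
        \<open>a\<close>.\<close>
      case ext
      obtain d0 d1 where d: "attached_lift Q u n x d0 d1" using cu ext by (auto simp: lifted_circle_def)
      obtain e0 e1 where e: "attached_lift Q w m x e0 e1" using cw ext by (auto simp: lifted_circle_def)
      show ?thesis
        using nz unfolding L3x[OF ext(1) d] R3x[OF ext(2) e] L2x[OF ext(2) e] R2x[OF ext(1) d]
          L1x[OF ext(1) d] R1x[OF ext(2) e]
        by (simp add: B E mult.commute)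
    qed
  qed
  then show ?thesis by (simp only: y3 z3)
qed

end

section \<open>Zigzags of cross arrows\<close>

text \<open>\<open>A\<close> and \<open>B\<close> are the lifted ends of the arrows, and
  \<open>I\<close> says that an arrow points from the \<open>A\<close> side to the \<open>B\<close>
  side. Each face has an arc, shorter than a turn, on exactly one circle, and directions
  alternate.\<close>

locale zigzag =
  fixes A B :: "int \<Rightarrow> int" and I :: "int \<Rightarrow> bool" and n m N :: nat
  assumes N_pos: "N > 0" and n_pos: "n > 0" and m_pos: "m > 0"
    and face: "\<And>x. (\<not> I x \<and> I (x + 1) \<and> B (x + 1) = B x \<and> A x < A (x + 1) \<and> A (x + 1) < A x + int n)
      \<or> (I x \<and> \<not> I (x + 1) \<and> A (x + 1) = A x \<and> B x < B (x + 1) \<and> B (x + 1) < B x + int m)"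
    and per: "\<And>x. A (x + int N) = A x + int n" "\<And>x. B (x + int N) = B x + int m"
      "\<And>x. I (x + int N) = I x"
begin

lemma swapped: "zigzag B A (\<lambda>x. \<not> I x) m n N"
proof
  show "(\<not> \<not> I x \<and> \<not> I (x + 1) \<and> A (x + 1) = A x \<and> B x < B (x + 1) \<and> B (x + 1) < B x + int m)
      \<or> (\<not> I x \<and> \<not> \<not> I (x + 1) \<and> B (x + 1) = B x \<and> A x < A (x + 1) \<and> A (x + 1) < A x + int n)" for x
    using face[of x] by blast
qed (use N_pos n_pos m_pos per in auto)

lemma B_mono: "x \<le> y \<Longrightarrow> B x \<le> B y"
proof (induction y rule: int_ge_induct)
  case (step y)
  then show ?case using face[of y] by auto
qed simp

lemma per_mult: "A (x + k * int N) = A x + k * int n" "B (x + k * int N) = B x + k * int m"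
  "I (x + k * int N) = I x"
proof -
  have "A (x + k * int N) = A x + k * int n \<and> B (x + k * int N) = B x + k * int m \<and> I (x + k * int N) = I x"
  proof (induction k rule: int_induct[of _ 0])
    case (step1 k)
    then show ?case using per[of "x + k * int N"] by (simp add: algebra_simps)
  next
    case (step2 k)
    then show ?case using per[of "x + (k - 1) * int N"] by (simp add: algebra_simps)
  qed simp
  then show "A (x + k * int N) = A x + k * int n" "B (x + k * int N) = B x + k * int m"
    "I (x + k * int N) = I x" by auto
qed

text \<open>\<open>B\<close> is monotone and, by periodicity, unbounded in both directions.\<close>

lemma first_exists: "\<exists>z. \<forall>x. z \<le> x \<longleftrightarrow> j \<le> B x"
proof -
  \<comment> \<open>Since \<open>m\<close> is at least 1, going \<open>k\<close> turns back takes
    \<open>B\<close> below \<open>j\<close>, and going \<open>k\<close> turns ahead takes it to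
    \<open>j\<close> or beyond.\<close>
  define k where "k = \<bar>j\<bar> + \<bar>B 0\<bar> + 1"
  have k: "k * int m \<ge> k" using mult_left_mono[of 1 "int m" k] m_pos by (simp add: k_def)
  have kj: "0 \<le> k" "B 0 - k < j" "j \<le> B 0 + k" unfolding k_def by arith+
  have "B (- (k * int N)) = B 0 - k * int m" using per_mult(2)[of 0 "- k"] by simp
  then have lo: "B (- (k * int N)) < j" using k kj by linarith
  have "B (k * int N) = B 0 + k * int m" using per_mult(2)[of 0 k] by simp
  then have hi: "j \<le> B (k * int N)" using k kj by linarith
  let ?R = "\<lambda>l. j \<le> B (- (k * int N) + int l)"
  have "- (k * int N) + int (nat (2 * k * int N)) = k * int N"
    using kj(1) by simp
  then have "?R (nat (2 * k * int N))" using hi by simp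
  then obtain l where l: "?R l" "\<And>l'. l' < l \<Longrightarrow> \<not> ?R l'"
    using exists_least_iff[of ?R] by blast
  have "l \<noteq> 0" using l(1) lo by (intro notI) simp
  then have l1: "l - 1 < l" "int (l - 1) = int l - 1" by auto
  define z where "z = - (k * int N) + int l"
  have z1: "z - 1 = - (k * int N) + int (l - 1)" using l1(2) by (simp add: z_def)
  have "\<not> j \<le> B (z - 1)" unfolding z1 by (rule l(2)[OF l1(1)])
  moreover have "j \<le> B z" unfolding z_def by (rule l(1))
  ultimately have "z \<le> x \<longleftrightarrow> j \<le> B x" for x
    using B_mono[of z x] B_mono[of x "z - 1"] by linarith
  then show ?thesis by blast
qed

text \<open>The lower adjoint of the monotone map \<open>B\<close>.\<close>

definition first :: "int \<Rightarrow> int" where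
  "first j = (SOME z. \<forall>x. z \<le> x \<longleftrightarrow> j \<le> B x)"

lemma first_le: "first j \<le> x \<longleftrightarrow> j \<le> B x"
  using someI_ex[OF first_exists, of j] by (auto simp: first_def)

text \<open>If position \<open>j\<close> carries arrows, the one leaving it points to
  \<open>height j\<close> and the one entering it comes from \<open>height (j + 1)\<close>.
  Otherwise these heights agree.\<close>

definition height :: "int \<Rightarrow> int" where
  "height j = A (first j)"

lemma first_per: "first (j + int m) = first j + int N"
proof -
  have "first (j + int m) \<le> x \<longleftrightarrow> first j + int N \<le> x" for x
  proof -
    have "first (j + int m) \<le> x \<longleftrightarrow> j + int m \<le> B (x - int N) + int m"
      using first_le[of "j + int m" x] per(2)[of "x - int N"] by simp
    also have "\<dots> \<longleftrightarrow> first j + int N \<le> x" using first_le[of j "x - int N"] by auto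
    finally show ?thesis .
  qed
  from this[of "first (j + int m)"] this[of "first j + int N"] show ?thesis by simp
qed

lemma height_per: "height (j + int m) = height j + int n"
  by (simp add: height_def first_per per)

text \<open>The face before \<open>first j\<close> advances \<open>B\<close>, so this arrow leaves
  \<open>j\<close>. The next face then advances \<open>A\<close>, and the one after it advances
  \<open>B\<close> past \<open>j\<close>; so the second arrow at \<open>j\<close> enters it.\<close>

lemma first_hit:
  assumes "B x = j"
  shows "B (first j) = j" "\<not> I (first j)" "I (first j + 1)" "B (first j + 1) = j"
    "first (j + 1) = first j + 2" "height (j + 1) = A (first j + 1)"
    "height j < height (j + 1)" "height (j + 1) < height j + int n"
proof -
  let ?x = "first j"
  have "j \<le> B ?x" using first_le[of j ?x] by simp
  moreover have "?x \<le> x" using first_le[of j x] assms by simp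
  ultimately show 1: "B ?x = j" using B_mono assms by fastforce
  have "B (?x - 1) < j" using first_le[of j "?x - 1"] by simp
  then show 2: "\<not> I ?x" using face[of "?x - 1"] 1 by auto
  then show 3: "I (?x + 1)" "B (?x + 1) = j" using face[of ?x] 1 by auto
  have 4: "A ?x < A (?x + 1)" "A (?x + 1) < A ?x + int n" using 2 face[of ?x] by auto
  have 5: "A (?x + 2) = A (?x + 1)" "j < B (?x + 2)" using face[of "?x + 1"] 3 by (auto simp: add.commute)
  have "first (j + 1) \<le> ?x + 2" using first_le[of "j + 1" "?x + 2"] 5 by simp
  moreover have "\<not> first (j + 1) \<le> ?x + 1" using first_le[of "j + 1" "?x + 1"] 3 by simp
  ultimately show 6: "first (j + 1) = ?x + 2" by linarith
  then show "height (j + 1) = A (?x + 1)" using 5 by (simp add: height_def)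
  then show "height j < height (j + 1)" "height (j + 1) < height j + int n"
    using 4 by (auto simp: height_def)
qed

lemma first_miss:
  assumes "\<And>x. B x \<noteq> j"
  shows "height (j + 1) = height j"
proof -
  have "j \<le> B x \<longleftrightarrow> j + 1 \<le> B x" for x using assms[of x] by linarith
  then have "first j \<le> x \<longleftrightarrow> first (j + 1) \<le> x" for x by (simp only: first_le)
  from this[of "first j"] this[of "first (j + 1)"] have "first (j + 1) = first j" by simp
  then show ?thesis by (simp add: height_def)
qed

lemma height_step: "height j \<le> height (j + 1)" "height (j + 1) < height j + int n"
  using first_hit(7,8)[of _ j] first_miss[of j] n_pos by (cases "\<exists>x. B x = j"; fastforce)+

lemma hits:
  assumes "B x = j"
  shows "\<not> I x \<Longrightarrow> x = first j" "I x \<Longrightarrow> x = first j + 1"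
proof -
  note f = first_hit[OF assms]
  have "first j \<le> x" using first_le[of j x] assms by simp
  moreover have "x < first j + 2" using first_le[of "j + 1" x] assms f(5) by simp
  ultimately have "x = first j \<or> x = first j + 1" by linarith
  then show "\<not> I x \<Longrightarrow> x = first j" "I x \<Longrightarrow> x = first j + 1" using f(2,3) by auto
qed

text \<open>Whole turns carry any arrow of the given direction with \<open>B\<close> end congruent
  to \<open>j\<close> to the unique arrow \<open>x1\<close>. One period thus contains a single
  candidate, and only the condition on its \<open>A\<close> end remains.\<close>

lemma card_hits:
  assumes x1: "B x1 = j" "I x1 = s" and unique: "\<And>x. B x = j \<Longrightarrow> I x = s \<Longrightarrow> x = x1"
  shows "card {x. x < N \<and> I (int x) = s \<and> int m dvd B (int x) - j \<and> int n dvd A (int x) - i} =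
    of_bool (int n dvd i - A x1)"
proof -
  define x0 where "x0 = nat (x1 mod int N)"
  have x0: "x0 < N" using N_pos by (simp add: x0_def nat_less_iff)
  have "int x0 = x1 mod int N" using N_pos by (simp add: x0_def)
  then have x0': "int x0 = x1 + (- (x1 div int N)) * int N"
    by (simp add: minus_div_mult_eq_mod[symmetric])
  have dvd: "int n dvd A (x1 + k * int N) - i \<longleftrightarrow> int n dvd i - A x1" for k
  proof -
    have "A (x1 + k * int N) - i = k * int n - (i - A x1)" by (simp add: per_mult)
    then show ?thesis by (simp only: dvd_diff_right_iff dvd_triv_right)
  qed
  have "x < N \<and> I (int x) = s \<and> int m dvd B (int x) - j \<and> int n dvd A (int x) - i \<longleftrightarrow>
      x = x0 \<and> int n dvd i - A x1" for x
  proof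
    assume x: "x < N \<and> I (int x) = s \<and> int m dvd B (int x) - j \<and> int n dvd A (int x) - i"
    then obtain k where k: "B (int x) - j = int m * k" by (auto elim: dvdE)
    have "B (int x + (- k) * int N) = j" "I (int x + (- k) * int N) = s"
      using k x unfolding per_mult by (auto simp: mult.commute)
    then have "int x + (- k) * int N = x1" by (rule unique)
    then have e: "int x = x1 + k * int N" by simp
    then have "x1 mod int N = int x mod int N" by simp
    then have "x = x0" using x by (simp add: x0_def)
    then show "x = x0 \<and> int n dvd i - A x1" using x e dvd by simp
  next
    assume x: "x = x0 \<and> int n dvd i - A x1"
    then show "x < N \<and> I (int x) = s \<and> int m dvd B (int x) - j \<and> int n dvd A (int x) - i"
      using x0 x1 dvd[of "- (x1 div int N)"] unfolding x0'[symmetric]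
      by (simp add: x0' per_mult(2,3) del: mult_minus_left)
  qed
  then have "{x. x < N \<and> I (int x) = s \<and> int m dvd B (int x) - j \<and> int n dvd A (int x) - i} =
      (if int n dvd i - A x1 then {x0} else {})" by auto
  then show ?thesis by simp
qed

lemma card_out:
  "card {x. x < N \<and> \<not> I (int x) \<and> int m dvd B (int x) - j \<and> int n dvd A (int x) - i} =
    of_bool (height j < height (j + 1) \<and> int n dvd i - height j)" (is ?out)
  and card_in:
  "card {x. x < N \<and> I (int x) \<and> int m dvd B (int x) - j \<and> int n dvd A (int x) - i} =
    of_bool (height j < height (j + 1) \<and> int n dvd i - height (j + 1))" (is ?in)
proof -
  have "?out \<and> ?in"
  proof (cases "\<exists>x. B x = j")
    case True
    then obtain x where x: "B x = j" by blast
    note f = first_hit[OF x]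
    have "card {x. x < N \<and> I (int x) = False \<and> int m dvd B (int x) - j \<and> int n dvd A (int x) - i} =
        of_bool (int n dvd i - A (first j))"
      by (rule card_hits) (use f(1,2) hits(1) in auto)
    moreover have "card {x. x < N \<and> I (int x) = True \<and> int m dvd B (int x) - j \<and> int n dvd A (int x) - i} =
        of_bool (int n dvd i - A (first j + 1))"
      by (rule card_hits) (use f(3,4) hits(2) in auto)
    ultimately show ?thesis using f(6,7) by (simp add: height_def)
  next
    case False
    have "\<not> int m dvd B x - j" for x
    proof
      assume "int m dvd B x - j"
      then obtain k where "B x - j = int m * k" by (auto elim: dvdE)
      then have "B (x + (- k) * int N) = j" unfolding per_mult by (simp add: mult.commute)
      then show False using False by blast
    qed
    then show ?thesis using first_miss[of j] False by auto
  qed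
  then show ?out ?in by auto
qed

text \<open>The left side says that \<open>first j\<close> precedes the first arrow reaching
  \<open>i\<close> on the \<open>A\<close> side; the adjunction for \<open>B\<close> turns this into
  a bound on \<open>j\<close>.\<close>

lemma galois: "height j < i \<longleftrightarrow> j \<le> zigzag.height B A i"
proof -
  interpret sw: zigzag B A "\<lambda>x. \<not> I x" m n N by (rule swapped)
  let ?z = "sw.first i"
  have "height j < i \<longleftrightarrow> \<not> ?z \<le> first j" by (simp add: height_def sw.first_le not_le)
  also have "\<dots> \<longleftrightarrow> first j \<le> ?z - 1" by linarith
  also have "\<dots> \<longleftrightarrow> j \<le> B (?z - 1)" by (rule first_le)
  \<comment> \<open>The face before \<open>?z\<close> advances \<open>A\<close> and therefore leaves
    \<open>B\<close> unchanged.\<close>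
  also have "B (?z - 1) = B ?z"
  proof -
    have "A (?z - 1) < i" "i \<le> A ?z" using sw.first_le[of i "?z - 1"] sw.first_le[of i ?z] by auto
    then show ?thesis using face[of "?z - 1"] by auto
  qed
  also have "B ?z = sw.height i" by (simp add: sw.height_def)
  finally show ?thesis .
qed

end

section \<open>Spider webs\<close>

lemma vert_eq_iff: "num_verts W c > 0 \<Longrightarrow>
    vert W c i = vert W c' i' \<longleftrightarrow> c = c' \<and> int (num_verts W c) dvd i - i'"
  by (auto simp: vert_def mod_eq_dvd_iff[symmetric] eq_nat_nat_iff)

lemma cross_arrow_simps:
  "fst (cross_arrow W c j) = (if inward W c j then vert W c (outer_end W c j) else vert W (Suc c) (inner_end W c j))"
  "snd (cross_arrow W c j) = (if inward W c j then vert W (Suc c) (inner_end W c j) else vert W c (outer_end W c j))"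
  by (auto simp: cross_arrow_def Let_def)

lemma fst_vert [simp]: "fst (vert W c i) = c"
  by (simp add: vert_def)

lemma directed_cycle_adjacent:
  assumes "directed_cycle (xs @ p # q # ys)"
  shows "snd p = fst q"
proof -
  let ?es = "xs @ p # q # ys"
  have "\<forall>i<length ?es. snd (?es ! i) = fst (?es ! (Suc i mod length ?es))"
    using assms unfolding directed_cycle_def by blast
  then have "snd (?es ! length xs) = fst (?es ! (Suc (length xs) mod length ?es))"
    by (rule allE[of _ "length xs"]) simp
  moreover have "Suc (length xs) mod length ?es = Suc (length xs)" by simp
  moreover have "?es ! Suc (length xs) = q" by (simp add: nth_append)
  ultimately show ?thesis by simp
qed

text \<open>An arc of a full turn would repeat a starting vertex among the sides of the face. The
  end of the arc is included because the following cross arrow starts there.\<close>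

lemma short_arc:
  assumes d: "distinct (map fst (map (circle_arrow W c) [i..i' - 1])  @ [vert W c i'])"
    and i: "i < i'" and n: "num_verts W c > 0"
  shows "i' < i + int (num_verts W c)"
proof (rule ccontr)
  assume "\<not> i' < i + int (num_verts W c)"
  moreover have "map fst (map (circle_arrow W c) [i..i' - 1])  @ [vert W c i'] = map (vert W c) [i..i']"
    using i by (simp add: upto_rec2 circle_arrow_def comp_def)
  then have "inj_on (vert W c) {i..i'}" using d by (simp only: distinct_map set_upto)
  ultimately show False
    using n vert_eq_iff[of W c i c "i + int (num_verts W c)"]
    by (auto dest: inj_onD[of _ _ i "i + int (num_verts W c)"])
qed

text \<open>All circle arrows run counterclockwise, so a directed walk around a face can use an arc
  of only one circle; having at least three sides forces that arc to be nonempty.\<close>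

lemma spider_web_face:
  assumes W: "spider_web W" and c: "Suc c < num_circles W"
  defines "A \<equiv> outer_end W c" and "B \<equiv> inner_end W c" and "I \<equiv> inward W c"
  shows "(\<not> I x \<and> I (x + 1) \<and> B (x + 1) = B x \<and> A x < A (x + 1) \<and> A (x + 1) < A x + int (num_verts W c))
    \<or> (I x \<and> \<not> I (x + 1) \<and> A (x + 1) = A x \<and> B x < B (x + 1) \<and> B (x + 1) < B x + int (num_verts W (Suc c)))"
proof -
  have n: "num_verts W c \<ge> 2" "num_verts W (Suc c) \<ge> 2"
    using W c by (auto simp: spider_web_def)
  have mono: "A x \<le> A (x + 1)" "B x \<le> B (x + 1)"
    using W c by (auto simp: spider_web_def annular_drawing_def A_def B_def)
  define X where "X = cross_arrow W c x"
  define X' where "X' = cross_arrow W c (x + 1)"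
  define LA where "LA = map (circle_arrow W c) [A x..A (x + 1) - 1]"
  define LB where "LB = map (circle_arrow W (Suc c)) [B x..B (x + 1) - 1]"
  have fs: "face_sides W c x = LA @ [X'] @ rev LB @ [X]"
    by (simp add: face_sides_def LA_def LB_def X_def X'_def A_def B_def)
  have "directed_cycle (face_sides W c x) \<or> directed_cycle (rev (face_sides W c x))"
    and len: "length (face_sides W c x) \<ge> 3"
    using W c by (auto simp: spider_web_def)
  then have dc: "directed_cycle (LA @ X' # rev LB @ [X]) \<or> directed_cycle (X # LB @ X' # rev LA)"
    and ne: "LA \<noteq> [] \<or> LB \<noteq> []"
    unfolding fs by auto
  have LA0: "LA = [] \<longleftrightarrow> A (x + 1) = A x" and LB0: "LB = [] \<longleftrightarrow> B (x + 1) = B x"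
    using mono by (auto simp: LA_def LB_def)
  have LAs: "LA = map (circle_arrow W c) [A x..A (x + 1) - 1 - 1] @ [circle_arrow W c (A (x + 1) - 1)]" if "LA \<noteq> []"
    using that LA0 mono by (simp add: LA_def upto_rec2)
  have LBs: "LB = map (circle_arrow W (Suc c)) [B x..B (x + 1) - 1 - 1] @ [circle_arrow W (Suc c) (B (x + 1) - 1)]" if "LB \<noteq> []"
    using that LB0 mono by (simp add: LB_def upto_rec2)
  have LB1: "LB = circle_arrow W (Suc c) (B x) # map (circle_arrow W (Suc c)) [B x + 1..B (x + 1) - 1]" if "LB \<noteq> []"
    using that LB0 mono by (simp add: LB_def upto_rec1)
  note X_simps = X_def X'_def cross_arrow_simps
  have nv: "vert W c i \<noteq> vert W (Suc c) i'" for i i' by (simp add: vert_def)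
  from dc show ?thesis
  proof
    assume d: "directed_cycle (LA @ X' # rev LB @ [X])"
    \<comment> \<open>This walk would pass an inner arc against its arrows: \<open>X'\<close> would
      have to end one position before its actual end, a different vertex since the circle has at
      least two.\<close>
    have LB: "LB = []"
    proof (rule ccontr)
      assume LB: "LB \<noteq> []"
      have "directed_cycle (LA @ X' # circle_arrow W (Suc c) (B (x + 1) - 1) #
          (rev (map (circle_arrow W (Suc c)) [B x..B (x + 1) - 1 - 1]) @ [X]))"
        using d unfolding LBs[OF LB] by simp
      from directed_cycle_adjacent[OF this] have "snd X' = vert W (Suc c) (B (x + 1) - 1)"
        by (simp add: circle_arrow_def)
      then show False using n nv vert_eq_iff[of W "Suc c" "B (x + 1)" "Suc c" "B (x + 1) - 1"]
        by (auto simp: X_simps B_def split: if_splits)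
    qed
    then have LA: "LA \<noteq> []" using ne by simp
    have d': "directed_cycle (LA @ X' # X # [])" using d LB by simp
    have "directed_cycle (map (circle_arrow W c) [A x..A (x + 1) - 1 - 1] @ circle_arrow W c (A (x + 1) - 1) # X' # [X])"
      using d' unfolding LAs[OF LA] by simp
    from directed_cycle_adjacent[OF this] have I': "I (x + 1)"
      using nv by (auto simp: X_simps circle_arrow_def I_def split: if_splits)
    have "\<not> I x" using directed_cycle_adjacent[OF d'] I' nv[symmetric]
      by (auto simp: X_simps circle_arrow_def I_def split: if_splits)
    moreover have "A x < A (x + 1)" using LA LA0 mono by auto
    moreover have "distinct (map fst LA @ [vert W c (A (x + 1))])"
      using d' I' by (auto simp: directed_cycle_def X_simps I_def A_def)
    then have "A (x + 1) < A x + int (num_verts W c)"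
      unfolding LA_def by (rule short_arc) (use \<open>A x < A (x + 1)\<close> n in auto)
    ultimately show ?thesis using LB LB0 I' by simp
  next
    assume d: "directed_cycle (X # LB @ X' # rev LA)"
    have LA: "LA = []"
    proof (rule ccontr)
      assume LA: "LA \<noteq> []"
      have "directed_cycle ((X # LB) @ X' # circle_arrow W c (A (x + 1) - 1) #
          rev (map (circle_arrow W c) [A x..A (x + 1) - 1 - 1]))"
        using d unfolding LAs[OF LA] by simp
      from directed_cycle_adjacent[OF this] have "snd X' = vert W c (A (x + 1) - 1)"
        by (simp add: circle_arrow_def)
      then show False using n nv[symmetric] vert_eq_iff[of W c "A (x + 1)" c "A (x + 1) - 1"]
        by (auto simp: X_simps A_def split: if_splits)
    qed
    then have LB: "LB \<noteq> []" using ne by simp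
    have d': "directed_cycle (X # LB @ [X'])" using d LA by simp
    have "directed_cycle ([] @ X # circle_arrow W (Suc c) (B x) # (map (circle_arrow W (Suc c)) [B x + 1..B (x + 1) - 1] @ [X']))"
      using d' LB1[OF LB] by simp
    from directed_cycle_adjacent[OF this] have I: "I x"
      using nv by (auto simp: X_simps circle_arrow_def I_def split: if_splits)
    have "directed_cycle ((X # map (circle_arrow W (Suc c)) [B x..B (x + 1) - 1 - 1]) @ circle_arrow W (Suc c) (B (x + 1) - 1) # X' # [])"
      using d' LBs[OF LB] by simp
    from directed_cycle_adjacent[OF this] have I': "\<not> I (x + 1)"
      using nv[symmetric] by (auto simp: X_simps circle_arrow_def I_def split: if_splits)
    moreover have "B x < B (x + 1)" using LB LB0 mono by auto
    moreover have "distinct (map fst LB @ [vert W (Suc c) (B (x + 1))])"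
      using d' I' by (auto simp: directed_cycle_def X_simps I_def B_def)
    then have "B (x + 1) < B x + int (num_verts W (Suc c))"
      unfolding LB_def by (rule short_arc) (use \<open>B x < B (x + 1)\<close> n in auto)
    ultimately show ?thesis using LA LA0 I by simp
  qed
qed

lemma spider_web_zigzag:
  assumes W: "spider_web W" and c: "Suc c < num_circles W"
  shows "zigzag (outer_end W c) (inner_end W c) (inward W c) (num_verts W c) (num_verts W (Suc c)) (num_cross W c)"
proof
  have "2 \<le> num_verts W c" "2 \<le> num_verts W (Suc c)" "2 \<le> num_cross W c"
    using W c by (auto simp: spider_web_def)
  then show "0 < num_cross W c" "0 < num_verts W c" "0 < num_verts W (Suc c)" by auto
qed (use spider_web_face[OF W c] W c in \<open>auto simp: spider_web_def annular_drawing_def\<close>)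

section \<open>Arrow multiplicities in a spider web\<close>

lemma count_list_concat_map: "count_list (concat (map f xs)) y = (\<Sum>x\<leftarrow>xs. count_list (f x) y)"
  by (induction xs) auto

lemma count_list_map_upt: "count_list (map f [0..<n]) y = card {i. i < n \<and> f i = y}"
proof (induction n)
  case (Suc n)
  have "{i. i < Suc n \<and> f i = y} = {i. i < n \<and> f i = y} \<union> (if f n = y then {n} else {})"
    by (auto simp: less_Suc_eq)
  then show ?case using Suc by simp
qed simp

text \<open>Multiplicities before the cancellation of 2-cycles.\<close>

definition arrow_count :: "web \<Rightarrow> vertex \<Rightarrow> vertex \<Rightarrow> nat" where
  "arrow_count W u v = count_list (web_arrows W) (u, v)"

lemma arrow_count_sum:
  "arrow_count W u v =
    (\<Sum>c<num_circles W. card {i. i < num_verts W c \<and> circle_arrow W c (int i) = (u, v)}) +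
    (\<Sum>c<num_circles W - 1. card {j. j < num_cross W c \<and> cross_arrow W c (int j) = (u, v)})"
  by (simp add: arrow_count_def web_arrows_def count_list_concat_map count_list_map_upt
      interv_sum_list_conv_sum_set_nat atLeast0LessThan)

lemma circle_arrow_circles: "circle_arrow W c i = (u, v) \<Longrightarrow> fst u = c \<and> fst v = c"
  by (auto simp: circle_arrow_def)

lemma cross_arrow_circles: "cross_arrow W c i = (u, v) \<Longrightarrow>
    (fst u = c \<and> fst v = Suc c) \<or> (fst u = Suc c \<and> fst v = c)"
  by (auto simp: cross_arrow_def Let_def split: if_splits)

lemma arrow_count_same_circle:
  assumes c: "c < num_circles W" and n: "num_verts W c > 0"
  shows "arrow_count W (vert W c i) (vert W c i') = of_bool (int (num_verts W c) dvd i' - i - 1)"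
proof -
  let ?n = "num_verts W c"
  let ?k = "nat (i mod int ?n)"
  have 0: "{j. j < num_cross W c' \<and> cross_arrow W c' (int j) = (vert W c i, vert W c i')} = {}" for c'
    by (auto dest: cross_arrow_circles)
  have 1: "{l. l < num_verts W c' \<and> circle_arrow W c' (int l) = (vert W c i, vert W c i')} = {}" if "c' \<noteq> c" for c'
    using that by (auto dest: circle_arrow_circles)
  have "l < ?n \<and> circle_arrow W c (int l) = (vert W c i, vert W c i') \<longleftrightarrow>
      l = ?k \<and> int ?n dvd i' - i - 1" for l
  proof -
    have "l < ?n \<and> int ?n dvd int l - i \<longleftrightarrow> l = ?k"
      using n by (auto simp: mod_eq_dvd_iff[symmetric] nat_less_iff)
    moreover have "int ?n dvd int l + 1 - i' \<longleftrightarrow> int ?n dvd i' - i - 1" if "int ?n dvd int l - i"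
    proof -
      have "int l + 1 - i' = (int l - i) - (i' - i - 1)" by simp
      then show ?thesis using that by (simp only: dvd_diff_right_iff)
    qed
    ultimately show ?thesis using n by (auto simp: circle_arrow_def vert_eq_iff)
  qed
  then have "{l. l < ?n \<and> circle_arrow W c (int l) = (vert W c i, vert W c i')} =
      (if int ?n dvd i' - i - 1 then {?k} else {})" by auto
  then have "card {l. l < ?n \<and> circle_arrow W c (int l) = (vert W c i, vert W c i')} =
      of_bool (int ?n dvd i' - i - 1)" by simp
  moreover have "(\<Sum>c'<num_circles W. card {l. l < num_verts W c' \<and> circle_arrow W c' (int l) = (vert W c i, vert W c i')})
     = card {l. l < ?n \<and> circle_arrow W c (int l) = (vert W c i, vert W c i')}"
    by (subst sum.remove[of _ c]) (use c 1 in auto)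
  ultimately show ?thesis unfolding arrow_count_sum 0 by simp
qed

lemma arrow_count_cross:
  assumes c: "Suc c < num_circles W" and n: "num_verts W c > 0" "num_verts W (Suc c) > 0"
  shows "arrow_count W (vert W (Suc c) j) (vert W c i) =
      card {x. x < num_cross W c \<and> \<not> inward W c (int x) \<and>
        int (num_verts W (Suc c)) dvd inner_end W c (int x) - j \<and>
        int (num_verts W c) dvd outer_end W c (int x) - i}"
    and "arrow_count W (vert W c i) (vert W (Suc c) j) =
      card {x. x < num_cross W c \<and> inward W c (int x) \<and>
        int (num_verts W (Suc c)) dvd inner_end W c (int x) - j \<and>
        int (num_verts W c) dvd outer_end W c (int x) - i}"
proof -
  have *: "arrow_count W u v = card {x. x < num_cross W c \<and> cross_arrow W c (int x) = (u, v)}"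
    if uv: "(fst u = c \<and> fst v = Suc c) \<or> (fst u = Suc c \<and> fst v = c)" for u v
  proof -
    have 0: "{l. l < num_verts W c' \<and> circle_arrow W c' (int l) = (u, v)} = {}" for c'
    proof -
      have "circle_arrow W c' (int l) \<noteq> (u, v)" for l
        using circle_arrow_circles[of W c' "int l" u v] uv by linarith
      then show ?thesis by simp
    qed
    have 1: "{x. x < num_cross W c' \<and> cross_arrow W c' (int x) = (u, v)} = {}" if "c' \<noteq> c" for c'
    proof -
      have "cross_arrow W c' (int x) \<noteq> (u, v)" for x
        using cross_arrow_circles[of W c' "int x" u v] uv that by linarith
      then show ?thesis by simp
    qed
    have "(\<Sum>c'<num_circles W - 1. card {x. x < num_cross W c' \<and> cross_arrow W c' (int x) = (u, v)})
       = card {x. x < num_cross W c \<and> cross_arrow W c (int x) = (u, v)}"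
      by (subst sum.remove[of _ c]) (use c 1 in auto)
    then show ?thesis unfolding arrow_count_sum 0 by simp
  qed
  have ne: "vert W c i \<noteq> vert W (Suc c) i'" "vert W (Suc c) i' \<noteq> vert W c i" for i i'
    by (simp_all add: vert_def)
  have e: "cross_arrow W c (int x) = (vert W (Suc c) j, vert W c i) \<longleftrightarrow>
      \<not> inward W c (int x) \<and> int (num_verts W (Suc c)) dvd inner_end W c (int x) - j \<and>
        int (num_verts W c) dvd outer_end W c (int x) - i"
    "cross_arrow W c (int x) = (vert W c i, vert W (Suc c) j) \<longleftrightarrow>
      inward W c (int x) \<and> int (num_verts W (Suc c)) dvd inner_end W c (int x) - j \<and>
        int (num_verts W c) dvd outer_end W c (int x) - i" for x
    by (auto simp: cross_arrow_def Let_def ne vert_eq_iff[OF n(1)] vert_eq_iff[OF n(2)])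
  show "arrow_count W (vert W (Suc c) j) (vert W c i) =
      card {x. x < num_cross W c \<and> \<not> inward W c (int x) \<and>
        int (num_verts W (Suc c)) dvd inner_end W c (int x) - j \<and>
        int (num_verts W c) dvd outer_end W c (int x) - i}"
    unfolding e(1)[symmetric] by (rule *) simp
  show "arrow_count W (vert W c i) (vert W (Suc c) j) =
      card {x. x < num_cross W c \<and> inward W c (int x) \<and>
        int (num_verts W (Suc c)) dvd inner_end W c (int x) - j \<and>
        int (num_verts W c) dvd outer_end W c (int x) - i}"
    unfolding e(2)[symmetric] by (rule *) simp
qed

lemma web_arrow_ends:
  assumes "(u, v) \<in> set (web_arrows W)"
  shows "\<exists>c i c' j. u = vert W c i \<and> v = vert W c' j \<and> c < num_circles W \<and> c' < num_circles W \<and>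
    (c' = c \<or> c' = Suc c \<or> Suc c' = c)"
proof -
  from assms consider (circle) c i where "c < num_circles W" "(u, v) = circle_arrow W c (int i)"
    | (cross) c j where "Suc c < num_circles W" "(u, v) = cross_arrow W c (int j)"
    by (auto simp: web_arrows_def less_diff_conv)
  then show ?thesis
  proof cases
    case circle
    then show ?thesis unfolding circle_arrow_def by blast
  next
    case cross
    then have "c < num_circles W" by simp
    moreover have "u = vert W c (outer_end W c (int j)) \<and> v = vert W (Suc c) (inner_end W c (int j)) \<or>
        u = vert W (Suc c) (inner_end W c (int j)) \<and> v = vert W c (outer_end W c (int j))"
      using cross(2) by (cases "inward W c (int j)") (simp_all add: cross_arrow_def Let_def)
    ultimately show ?thesis using cross(1) by blast
  qed
qed

text \<open>Vertices away from the neighbouring circles can thereby be attached trivially.\<close>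

lemma arrow_count_neighbour:
  assumes "arrow_count W (vert W c i) x \<noteq> 0 \<or> arrow_count W x (vert W c i) \<noteq> 0"
  shows "\<exists>c' j. c' < num_circles W \<and> x = vert W c' j \<and> (c' = c \<or> c' = Suc c \<or> Suc c' = c)"
proof -
  have "(vert W c i, x) \<in> set (web_arrows W) \<or> (x, vert W c i) \<in> set (web_arrows W)"
    using assms by (auto simp: arrow_count_def count_list_0_iff)
  then show ?thesis
  proof
    assume "(vert W c i, x) \<in> set (web_arrows W)"
    from web_arrow_ends[OF this] obtain d l c' j where
      d: "vert W c i = vert W d l" and "x = vert W c' j" "c' < num_circles W" "c' = d \<or> c' = Suc d \<or> Suc c' = d"
      by blast
    moreover have "d = c" using arg_cong[OF d, of fst] by simp
    ultimately show ?thesis by blast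
  next
    assume "(x, vert W c i) \<in> set (web_arrows W)"
    from web_arrow_ends[OF this] obtain d l c' j where
      d: "vert W c i = vert W d l" and "x = vert W c' j" "c' < num_circles W" "d = c' \<or> d = Suc c' \<or> Suc d = c'"
      by blast
    moreover have "d = c" using arg_cong[OF d, of fst] by simp
    ultimately show ?thesis by blast
  qed
qed

lemma spider_web_quiver_eq: "spider_web_quiver W u v = arrow_count W u v - arrow_count W v u"
  by (simp add: spider_web_quiver_def cancel_2cycles_def arrow_count_def)

section \<open>The height functions of two adjacent circles in a web\<close>

text \<open>Takes positions on circle \<open>Suc c\<close> to positions on circle \<open>c\<close>,
  and \<open>web_height_out\<close> goes the opposite way. They serve as \<open>h\<close> and
  \<open>g\<close> in \<open>two_circles\<close>.\<close>

definition web_height_in :: "web \<Rightarrow> nat \<Rightarrow> int \<Rightarrow> int" where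
  "web_height_in W c = zigzag.height (outer_end W c) (inner_end W c)"

definition web_height_out :: "web \<Rightarrow> nat \<Rightarrow> int \<Rightarrow> int" where
  "web_height_out W c = zigzag.height (inner_end W c) (outer_end W c)"

lemma spider_web_attached:
  assumes W: "spider_web W" and c: "Suc c < num_circles W"
  shows "attached_lift (spider_web_quiver W) (vert W c) (num_verts W c) (vert W (Suc c) j)
      (web_height_in W c j) (web_height_in W c (j + 1))"
    and "attached_lift (spider_web_quiver W) (vert W (Suc c)) (num_verts W (Suc c)) (vert W c i)
      (web_height_out W c i) (web_height_out W c (i + 1))"
proof -
  interpret z: zigzag "outer_end W c" "inner_end W c" "inward W c" "num_verts W c" "num_verts W (Suc c)" "num_cross W c"
    by (rule spider_web_zigzag[OF W c])
  interpret sw: zigzag "inner_end W c" "outer_end W c" "\<lambda>x. \<not> inward W c x" "num_verts W (Suc c)" "num_verts W c" "num_cross W c"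
    by (rule z.swapped)
  \<comment> \<open>Ends less than a turn apart are different vertices, so no cross arrow is lost
    when 2-cycles are cancelled.\<close>
  have small: "\<not> (int k dvd i - a \<and> int k dvd i - b)" if "a < b" "b < a + int k" for a b i :: int and k
  proof
    assume "int k dvd i - a \<and> int k dvd i - b"
    then have "int k dvd (i - a) - (i - b)" using dvd_diff[of "int k" "i - a" "i - b"] by blast
    then have "int k dvd b - a" by simp
    then show False using that zdvd_not_zless[of "b - a" "int k"] by auto
  qed
  note cnt = arrow_count_cross[OF c z.n_pos z.m_pos]
  note cin = z.card_out z.card_in
  \<comment> \<open>Seen from the outer circle, the inward arrows are the outgoing ones.\<close>
  have cout: "card {x. x < num_cross W c \<and> inward W c (int x) \<and>
        int (num_verts W (Suc c)) dvd inner_end W c (int x) - j \<and>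
        int (num_verts W c) dvd outer_end W c (int x) - i} =
      of_bool (sw.height i < sw.height (i + 1) \<and> int (num_verts W (Suc c)) dvd j - sw.height i)"
    "card {x. x < num_cross W c \<and> \<not> inward W c (int x) \<and>
        int (num_verts W (Suc c)) dvd inner_end W c (int x) - j \<and>
        int (num_verts W c) dvd outer_end W c (int x) - i} =
      of_bool (sw.height i < sw.height (i + 1) \<and> int (num_verts W (Suc c)) dvd j - sw.height (i + 1))" for i j
    using sw.card_out[of i j] sw.card_in[of i j] by (simp_all add: conj_commute[of "_ dvd _ - j"])
  show "attached_lift (spider_web_quiver W) (vert W c) (num_verts W c) (vert W (Suc c) j)
      (web_height_in W c j) (web_height_in W c (j + 1))"
    unfolding attached_lift_def web_height_in_def
    using z.height_step[of j] small[of "z.height j" "z.height (j + 1)" "num_verts W c"]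
    by (auto simp: spider_web_quiver_eq cnt cin)
  show "attached_lift (spider_web_quiver W) (vert W (Suc c)) (num_verts W (Suc c)) (vert W c i)
      (web_height_out W c i) (web_height_out W c (i + 1))"
    unfolding attached_lift_def web_height_out_def
    using sw.height_step[of i] small[of "sw.height i" "sw.height (i + 1)" "num_verts W (Suc c)"]
    by (auto simp: spider_web_quiver_eq cnt cout)
qed

lemma spider_web_lifted_circle:
  assumes W: "spider_web W" and c: "c < num_circles W"
  shows "lifted_circle (spider_web_quiver W) (vert W c) (num_verts W c)"
proof -
  let ?n = "num_verts W c"
  have n: "2 \<le> ?n" using W c by (auto simp: spider_web_def)
  have circ: "spider_web_quiver W (vert W c i) (vert W c j) = of_bool (3 \<le> ?n \<and> int ?n dvd j - i - 1)" for i j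
  proof -
    \<comment> \<open>Opposite arrows between the same two vertices force the number of vertices to
      divide 2.\<close>
    have "?n = 2" if "int ?n dvd j - i - 1" "int ?n dvd i - j - 1"
    proof -
      have "int ?n dvd - ((j - i - 1) + (i - j - 1))" using that by (simp only: dvd_minus_iff dvd_add)
      then have "int ?n dvd 2" by simp
      then show ?thesis using n zdvd_imp_le[of "int ?n" 2] by simp
    qed
    note two = this
    have cnt: "spider_web_quiver W (vert W c i) (vert W c j) =
        of_bool (int ?n dvd j - i - 1) - of_bool (int ?n dvd i - j - 1)"
      using n c by (simp add: spider_web_quiver_eq arrow_count_same_circle)
    show ?thesis
    proof (cases "?n = 2")
      case True
      \<comment> \<open>On two vertices the arrows of both directions are present or absent
        together, and so cancel.\<close>
      have "int ?n dvd j - i - 1 \<longleftrightarrow> int ?n dvd i - j - 1"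
        unfolding True by presburger
      then show ?thesis unfolding cnt using True by simp
    next
      case False
      then have "3 \<le> ?n" using n by linarith
      moreover have "\<not> (int ?n dvd j - i - 1 \<and> int ?n dvd i - j - 1)" using two False by blast
      ultimately show ?thesis unfolding cnt by auto
    qed
  qed
  have ext: "\<exists>a b. attached_lift (spider_web_quiver W) (vert W c) ?n x a b" if x: "x \<notin> range (vert W c)" for x
  proof (cases "\<exists>i. arrow_count W (vert W c i) x \<noteq> 0 \<or> arrow_count W x (vert W c i) \<noteq> 0")
    case True
    then obtain i where "arrow_count W (vert W c i) x \<noteq> 0 \<or> arrow_count W x (vert W c i) \<noteq> 0" ..
    from arrow_count_neighbour[OF this] obtain c' j
      where c': "c' < num_circles W" "x = vert W c' j" "c' = c \<or> c' = Suc c \<or> Suc c' = c" by blast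
    then consider "c' = Suc c" | "Suc c' = c" using x by auto
    then show ?thesis
    proof cases
      case 1
      then show ?thesis using c' spider_web_attached(1)[OF W, of c j] by auto
    next
      case 2
      then show ?thesis using c c' spider_web_attached(2)[OF W, of c' j] by auto
    qed
  next
    case False
    then have "attached_lift (spider_web_quiver W) (vert W c) ?n x 0 0"
      using n by (auto simp: attached_lift_def spider_web_quiver_eq)
    then show ?thesis by blast
  qed
  show ?thesis
    unfolding lifted_circle_def
    using n circ ext is_quiver_spider_web_quiver vert_eq_iff[of W c _ c] by auto
qed

lemma spider_web_two_circles:
  assumes W: "spider_web W" and c: "Suc c < num_circles W" and P: "semifield_in P"
  shows "two_circles P (spider_web_quiver W) (vert W c) (vert W (Suc c)) (num_verts W c) (num_verts W (Suc c))
    (web_height_out W c) (web_height_in W c)"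
proof -
  interpret z: zigzag "outer_end W c" "inner_end W c" "inward W c" "num_verts W c" "num_verts W (Suc c)" "num_cross W c"
    by (rule spider_web_zigzag[OF W c])
  interpret sw: zigzag "inner_end W c" "outer_end W c" "\<lambda>x. \<not> inward W c x" "num_verts W (Suc c)" "num_verts W c" "num_cross W c"
    by (rule z.swapped)
  show ?thesis
  proof
    show "semifield_in P" by (rule P)
    show "lifted_circle (spider_web_quiver W) (vert W c) (num_verts W c)"
      "lifted_circle (spider_web_quiver W) (vert W (Suc c)) (num_verts W (Suc c))"
      using spider_web_lifted_circle[OF W] c by auto
    show "vert W c i \<noteq> vert W (Suc c) j" for i j by (simp add: vert_def)
    show "attached_lift (spider_web_quiver W) (vert W c) (num_verts W c) (vert W (Suc c) j)
      (web_height_in W c j) (web_height_in W c (j + 1))" for j by (rule spider_web_attached[OF W c])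
    show "attached_lift (spider_web_quiver W) (vert W (Suc c)) (num_verts W (Suc c)) (vert W c i)
      (web_height_out W c i) (web_height_out W c (i + 1))" for i by (rule spider_web_attached[OF W c])
    show "web_height_in W c j < i \<longleftrightarrow> j \<le> web_height_out W c i" for i j
      unfolding web_height_in_def web_height_out_def by (rule z.galois)
    show "web_height_in W c (j + int (num_verts W (Suc c))) = web_height_in W c j + int (num_verts W c)" for j
      unfolding web_height_in_def by (rule z.height_per)
    show "web_height_out W c (i + int (num_verts W c)) = web_height_out W c i + int (num_verts W (Suc c))" for i
      unfolding web_height_out_def by (rule sw.height_per)
  qed
qed

theorem theorem6p10:
  fixes W :: web and C D :: nat and a b :: int
    and P :: "'a::field set" and y :: "vertex \<Rightarrow> 'a"
  assumes "spider_web W"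
    and "C < num_circles W" and "D < num_circles W"
    and "D = Suc C \<or> C = Suc D"
    and "semifield_in P" and "\<forall>v\<in>web_verts W. y v \<in> P"
  defines "\<tau>\<^sub>C \<equiv> tau (circle_from W C a) :: (vertex, 'a) seed \<Rightarrow> (vertex, 'a) seed"
    and "\<tau>\<^sub>D \<equiv> tau (circle_from W D b) :: (vertex, 'a) seed \<Rightarrow> (vertex, 'a) seed"
    and "S \<equiv> (spider_web_quiver W, y)"
  shows "\<forall>v\<in>web_verts W. snd (\<tau>\<^sub>C (\<tau>\<^sub>D (\<tau>\<^sub>C S))) v = snd (\<tau>\<^sub>D (\<tau>\<^sub>C (\<tau>\<^sub>D S))) v"
proof -
  have y: "y (vert W c i) \<in> P" if c: "c < num_circles W" for c i
  proof -
    have "num_verts W c \<ge> 2" using assms(1) c by (auto simp: spider_web_def)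
    then have "vert W c i \<in> web_verts W" using c by (auto simp: web_verts_def vert_def nat_less_iff)
    then show ?thesis using assms(6) by blast
  qed
  \<comment> \<open>If \<open>C\<close> is the inner circle, the swapped pair is used and the two
    height functions exchange roles.\<close>
  have "two_circles P (spider_web_quiver W) (vert W C) (vert W D) (num_verts W C) (num_verts W D)
      (if D = Suc C then web_height_out W C else web_height_in W D)
      (if D = Suc C then web_height_in W C else web_height_out W D)"
    using assms(4) spider_web_two_circles[OF assms(1) _ assms(5)]
      two_circles.swapped[OF spider_web_two_circles[OF assms(1) _ assms(5)]] assms(2,3) by auto
  from two_circles.braid[OF this y[OF assms(2)] y[OF assms(3)]]
  show ?thesis
    unfolding \<tau>\<^sub>C_def \<tau>\<^sub>D_def S_def circle_from_def by blast
qed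

end
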